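(* Let $\Omega\subset\mathbb{R}^n$ be a bounded, connected, open set, $v$ a weight on $\Omega$, and $Q$ a matrix function on $\Omega$. Suppose there is a constant $C$ such that $\big(\int_\Omega|\varphi|^2v\,dx\big)^{\frac12}\le C\big(\int_\Omega|\sqrt Q\nabla\varphi|^2dx\big)^{\frac12}$ for all $\varphi\in Q\mathrm{Lip}_0(v,\Omega)$. Let $N\in\mathbb N$, $f\in L^2(v,\Omega)$, $\mathbf g\in L^2(v,\Omega,\mathbb{R}^N)$, and let $\mathbf T=(T_1,\dots,T_N)$ be an $N$-tuple of degenerate subunit vector fields. If $F\in L^\infty(v,\Omega)$ is nonnegative, then the Dirichlet problem $$-v^{-1}\operatorname{div}(Q\nabla u)+Fu=f+\mathbf T'\mathbf g\ \text{in }\Omega,\qquad u=0\ \text{on }\partial\Omega,$$ has a unique degenerate weak solution $u\in QH^{1,2}_0(v,\Omega)$.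
   Context: A weight is a nonnegative measurable function $v$ with $0<v(x)<\infty$ a.e. A matrix function $Q$ on $\Omega$ is a map whose values are real, symmetric, positive semidefinite $n\times n$ matrices, with measurable entries finite a.e., and with $Q(x)$ invertible for a.e. $x$; $\sqrt Q$ is the positive semidefinite square root. $L^p(v,\Omega)$ has norm $(\int_\Omega|f|^pv\,dx)^{1/p}$ (essential supremum if $p=\infty$); $\mathbf f\in L^p(v,\Omega,\mathbb{R}^N)$ means $|\mathbf f|\in L^p(v,\Omega)$. $QL^2(\Omega)$ is the space of measurable $\mathbf f:\Omega\to\mathbb{R}^n$ with $\|\mathbf f\|_{QL^2(\Omega)}=(\int_\Omega|\sqrt Q\mathbf f|^2dx)^{1/2}<\infty$. $\mathrm{Lip}_{\mathrm{loc}}(\Omega)$: functions Lipschitz on compact subsets of $\Omega$; $\mathrm{Lip}_0(\Omega)$: Lipschitz functions with compact support in $\Omega$. $Q\mathrm{Lip}_{\mathrm{loc}}(v,\Omega)$ (resp. $Q\mathrm{Lip}_0(v,\Omega)$) is the set of $\varphi$ in $\mathrm{Lip}_{\mathrm{loc}}(\Omega)$ (resp. $\mathrm{Lip}_0(\Omega)$) with $\|\varphi\|_{QH^{1,2}(v,\Omega)}=\|\varphi\|_{L^2(v,\Omega)}+\|\nabla\varphi\|_{QL^2(\Omega)}<\infty$ ($Q\mathrm{Lip}_0(v,\Omega)$ is assumed nontrivial). $QH^{1,2}(v,\Omega)$ (resp. $QH^{1,2}_0(v,\Omega)$) is the closure of $\{(\varphi,\nabla\varphi)\}$, $\varphi\in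 Q\mathrm{Lip}_{\mathrm{loc}}(v,\Omega)$ (resp. $Q\mathrm{Lip}_0(v,\Omega)$), in $L^2(v,\Omega)\oplus QL^2(\Omega)$. Elements are pairs $(u,\mathbf g)$ with norm $\|u\|_{L^2(v,\Omega)}+\|\mathbf g\|_{QL^2(\Omega)}$; one writes $\nabla u:=\mathbf g$ by convention (it need not be a weak derivative nor be determined by $u$) and often just $u$ for the pair. A vector field is $V=\mathbf v\cdot\nabla$ with $\mathbf v:\Omega\to\mathbb{R}^n$ measurable, acting by $Vu=\mathbf v\cdot\nabla u$. It is degenerate subunit if there is a constant $C(V)$ with $\|Vu\|_{L^2(v,\Omega)}\le C(V)\|u\|_{QH^{1,2}(v,\Omega)}$ for all $u\in QH^{1,2}(v,\Omega)$. With $T_i=\mathbf t_i\cdot\nabla$, $\mathbf T'\mathbf g=-\sum_iv^{-1}\operatorname{div}(\mathbf t_ig_iv)$ formally, and $\mathbf g\cdot\mathbf T\varphi=\sum_ig_iT_i\varphi$. Degenerate weak solution: a pair $(u,\nabla u)\in QH^{1,2}_0(v,\Omega)$ such that for all $\varphi\in Q\mathrm{Lip}_0(v,\Omega)$, $$\int_\Omega Q\nabla u\cdot\nabla\varphi\,dx+\int_\Omega Fu\varphi\,v\,dx=\int_\Omega f\varphi\,v\,dx+\int_\Omega\mathbf g\cdot\mathbf T\varphi\,v\,dx.$$ *)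

theory Defs
  imports "HOL-Analysis.Analysis" "HOL-Probability.Essential_Supremum"
begin

text \<open>
  Functions on \<open>\<Omega>\<close> are total functions of which only the values on \<open>\<Omega>\<close> matter. Elements of the
  function spaces are represented by measurable functions rather than by equivalence classes
  modulo null sets. Hence identity of elements is equality almost everywhere.
\<close>

section \<open>Weights and matrix functions\<close>

definition weight :: "(real^'n) set \<Rightarrow> (real^'n \<Rightarrow> ennreal) \<Rightarrow> bool" where
  "weight \<Omega> v \<longleftrightarrow> v \<in> borel_measurable (lebesgue_on \<Omega>) \<and>
     (AE x in lebesgue_on \<Omega>. 0 < v x \<and> v x < \<infinity>)"

abbreviation weighted :: "(real^'n) set \<Rightarrow> (real^'n \<Rightarrow> ennreal) \<Rightarrow> (real^'n) measure" where
  "weighted \<Omega> v \<equiv> density (lebesgue_on \<Omega>) v"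

definition pos_semidef :: "real^'n^'n \<Rightarrow> bool" where
  "pos_semidef A \<longleftrightarrow> transpose A = A \<and> (\<forall>x. 0 \<le> x \<bullet> (A *v x))"

definition psd_sqrt :: "real^'n^'n \<Rightarrow> real^'n^'n" where
  "psd_sqrt A = (THE B. pos_semidef B \<and> B ** B = A)"

definition matrix_function :: "(real^'n) set \<Rightarrow> (real^'n \<Rightarrow> real^'n^'n) \<Rightarrow> bool" where
  "matrix_function \<Omega> Q \<longleftrightarrow>
     (\<forall>x\<in>\<Omega>. pos_semidef (Q x)) \<and>
     (\<forall>i j. (\<lambda>x. Q x $ i $ j) \<in> borel_measurable (lebesgue_on \<Omega>)) \<and>
     (AE x in lebesgue_on \<Omega>. invertible (Q x))"

section \<open>Lebesgue spaces\<close>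

definition L2 :: "'a measure \<Rightarrow> ('a \<Rightarrow> 'b::real_normed_vector) set" where
  "L2 M = {f \<in> borel_measurable M. (\<integral>\<^sup>+x. ennreal ((norm (f x))\<^sup>2) \<partial>M) < \<infinity>}"

definition L2_norm :: "'a measure \<Rightarrow> ('a \<Rightarrow> 'b::real_normed_vector) \<Rightarrow> real" where
  "L2_norm M f = sqrt (LINT x|M. (norm (f x))\<^sup>2)"

definition Linfty :: "'a measure \<Rightarrow> ('a \<Rightarrow> real) set" where
  "Linfty M = {f \<in> borel_measurable M. esssup M (\<lambda>x. ereal \<bar>f x\<bar>) < \<infinity>}"

definition QL2 :: "(real^'n) set \<Rightarrow> (real^'n \<Rightarrow> real^'n^'n) \<Rightarrow> (real^'n \<Rightarrow> real^'n) set" where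
  "QL2 \<Omega> Q = {g \<in> borel_measurable (lebesgue_on \<Omega>).
     (\<integral>\<^sup>+x. ennreal ((norm (psd_sqrt (Q x) *v g x))\<^sup>2) \<partial>lebesgue_on \<Omega>) < \<infinity>}"

definition QL2_norm :: "(real^'n) set \<Rightarrow> (real^'n \<Rightarrow> real^'n^'n) \<Rightarrow> (real^'n \<Rightarrow> real^'n) \<Rightarrow> real" where
  "QL2_norm \<Omega> Q g = sqrt (LINT x|lebesgue_on \<Omega>. (norm (psd_sqrt (Q x) *v g x))\<^sup>2)"

definition QH_norm :: "(real^'n) set \<Rightarrow> (real^'n \<Rightarrow> ennreal) \<Rightarrow> (real^'n \<Rightarrow> real^'n^'n) \<Rightarrow>
    (real^'n \<Rightarrow> real) \<Rightarrow> (real^'n \<Rightarrow> real^'n) \<Rightarrow> real" where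
  "QH_norm \<Omega> v Q u g = L2_norm (weighted \<Omega> v) u + QL2_norm \<Omega> Q g"

section \<open>Lipschitz functions and their gradients\<close>

definition Lip_loc :: "(real^'n) set \<Rightarrow> (real^'n \<Rightarrow> real) set" where
  "Lip_loc \<Omega> = {\<phi>. \<forall>K. compact K \<and> K \<subseteq> \<Omega> \<longrightarrow> (\<exists>C. C-lipschitz_on K \<phi>)}"

definition Lip_0 :: "(real^'n) set \<Rightarrow> (real^'n \<Rightarrow> real) set" where
  "Lip_0 \<Omega> = {\<phi>. (\<exists>C. C-lipschitz_on \<Omega> \<phi>) \<and>
     compact (closure (support_on \<Omega> \<phi>)) \<and> closure (support_on \<Omega> \<phi>) \<subseteq> \<Omega>}"

text \<open>
  By Rademacher's theorem a locally Lipschitz function has a classical gradient at almost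
  every point, so its gradient is a function determined up to null sets. The predicate below
  says that \<open>h\<close> is a representative of it.
\<close>

definition is_gradient :: "(real^'n) set \<Rightarrow> (real^'n \<Rightarrow> real) \<Rightarrow> (real^'n \<Rightarrow> real^'n) \<Rightarrow> bool" where
  "is_gradient \<Omega> \<phi> h \<longleftrightarrow> (AE x in lebesgue_on \<Omega>. GDERIV \<phi> x :> h x)"

text \<open>
  The members of \<open>QLip_loc\<close> and \<open>QLip_0\<close> are the functions \<open>\<phi>\<close> together with their gradients,
  that is, the pairs \<open>(\<phi>, \<nabla>\<phi>)\<close>.
\<close>

definition QLip_loc :: "(real^'n) set \<Rightarrow> (real^'n \<Rightarrow> ennreal) \<Rightarrow> (real^'n \<Rightarrow> real^'n^'n) \<Rightarrow>
    ((real^'n \<Rightarrow> real) \<times> (real^'n \<Rightarrow> real^'n)) set" where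
  "QLip_loc \<Omega> v Q = {(\<phi>, h). \<phi> \<in> Lip_loc \<Omega> \<and> is_gradient \<Omega> \<phi> h \<and>
     \<phi> \<in> L2 (weighted \<Omega> v) \<and> h \<in> QL2 \<Omega> Q}"

definition QLip_0 :: "(real^'n) set \<Rightarrow> (real^'n \<Rightarrow> ennreal) \<Rightarrow> (real^'n \<Rightarrow> real^'n^'n) \<Rightarrow>
    ((real^'n \<Rightarrow> real) \<times> (real^'n \<Rightarrow> real^'n)) set" where
  "QLip_0 \<Omega> v Q = {(\<phi>, h). \<phi> \<in> Lip_0 \<Omega> \<and> is_gradient \<Omega> \<phi> h \<and>
     \<phi> \<in> L2 (weighted \<Omega> v) \<and> h \<in> QL2 \<Omega> Q}"

section \<open>Degenerate Sobolev spaces\<close>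

definition QH_closure :: "(real^'n) set \<Rightarrow> (real^'n \<Rightarrow> ennreal) \<Rightarrow> (real^'n \<Rightarrow> real^'n^'n) \<Rightarrow>
    ((real^'n \<Rightarrow> real) \<times> (real^'n \<Rightarrow> real^'n)) set \<Rightarrow>
    ((real^'n \<Rightarrow> real) \<times> (real^'n \<Rightarrow> real^'n)) set" where
  "QH_closure \<Omega> v Q S = {(u, g). u \<in> L2 (weighted \<Omega> v) \<and> g \<in> QL2 \<Omega> Q \<and>
     (\<forall>\<epsilon>>0. \<exists>(\<phi>, h)\<in>S. QH_norm \<Omega> v Q (\<lambda>x. u x - \<phi> x) (\<lambda>x. g x - h x) < \<epsilon>)}"

definition QH :: "(real^'n) set \<Rightarrow> (real^'n \<Rightarrow> ennreal) \<Rightarrow> (real^'n \<Rightarrow> real^'n^'n) \<Rightarrow>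
    ((real^'n \<Rightarrow> real) \<times> (real^'n \<Rightarrow> real^'n)) set" where
  "QH \<Omega> v Q = QH_closure \<Omega> v Q (QLip_loc \<Omega> v Q)"

definition QH_0 :: "(real^'n) set \<Rightarrow> (real^'n \<Rightarrow> ennreal) \<Rightarrow> (real^'n \<Rightarrow> real^'n^'n) \<Rightarrow>
    ((real^'n \<Rightarrow> real) \<times> (real^'n \<Rightarrow> real^'n)) set" where
  "QH_0 \<Omega> v Q = QH_closure \<Omega> v Q (QLip_0 \<Omega> v Q)"

section \<open>Degenerate subunit vector fields and weak solutions\<close>

text \<open>
  The vector field \<open>V = t \<bullet> \<nabla>\<close> is represented by its coefficient function \<open>t\<close>. Membership in
  \<open>L2\<close> is required explicitly because \<open>L2_norm\<close> is \<open>0\<close>, not infinite, when the integral diverges.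
\<close>

definition degenerate_subunit :: "(real^'n) set \<Rightarrow> (real^'n \<Rightarrow> ennreal) \<Rightarrow>
    (real^'n \<Rightarrow> real^'n^'n) \<Rightarrow> (real^'n \<Rightarrow> real^'n) \<Rightarrow> bool" where
  "degenerate_subunit \<Omega> v Q t \<longleftrightarrow> t \<in> borel_measurable (lebesgue_on \<Omega>) \<and>
     (\<exists>C. \<forall>(u, g)\<in>QH \<Omega> v Q. (\<lambda>x. t x \<bullet> g x) \<in> L2 (weighted \<Omega> v) \<and>
        L2_norm (weighted \<Omega> v) (\<lambda>x. t x \<bullet> g x) \<le> C * QH_norm \<Omega> v Q u g)"

definition degenerate_weak_solution :: "(real^'n) set \<Rightarrow> (real^'n \<Rightarrow> ennreal) \<Rightarrow>
    (real^'n \<Rightarrow> real^'n^'n) \<Rightarrow> (real^'n \<Rightarrow> real) \<Rightarrow> (real^'n \<Rightarrow> real) \<Rightarrow>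
    ('N::finite \<Rightarrow> real^'n \<Rightarrow> real^'n) \<Rightarrow> (real^'n \<Rightarrow> real^'N) \<Rightarrow>
    (real^'n \<Rightarrow> real) \<times> (real^'n \<Rightarrow> real^'n) \<Rightarrow> bool" where
  "degenerate_weak_solution \<Omega> v Q F f t g = (\<lambda>(u, du).
     (u, du) \<in> QH_0 \<Omega> v Q \<and>
     (\<forall>(\<phi>, d\<phi>)\<in>QLip_0 \<Omega> v Q.
        (LINT x|lebesgue_on \<Omega>. (Q x *v du x) \<bullet> d\<phi> x) + (LINT x|weighted \<Omega> v. F x * u x * \<phi> x) =
        (LINT x|weighted \<Omega> v. f x * \<phi> x) +
        (LINT x|weighted \<Omega> v. (\<Sum>i\<in>UNIV. g x $ i * (t i x \<bullet> d\<phi> x)))))"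

end

theory Submission
  imports Defs
begin

text \<open>
  The equation is the Euler-Lagrange equation of a convex quadratic functional. With
  \<open>w = (u, \<nabla>u)\<close> and \<open>z = (\<phi>, \<nabla>\<phi>)\<close>, the left-hand side is a symmetric bilinear form, the energy
  \<open>B w z = \<integral> Q \<nabla>u \<bullet> \<nabla>\<phi> + \<integral> F u \<phi> v\<close>, and the right-hand side is a linear functional \<open>L z\<close>.
  Since \<open>F \<ge> 0\<close>, the energy dominates the square of the \<open>QL\<^sup>2\<close> norm of the gradient, and by the
  Poincare inequality it dominates the square of the whole norm of \<open>QH\<^sub>0\<close>. The subunit condition bounds
  each \<open>T\<^sub>i \<phi>\<close> in \<open>L\<^sup>2(v)\<close> by that same norm, so \<open>L\<close> is bounded in the energy norm (\<open>load_bound\<close>).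

  Existence is then the direct method. A minimizing sequence of \<open>B w w / 2 - L w\<close> is chosen among the
  Lipschitz functions with compact support, the same functions against which the equation is tested:
  the sequence is Cauchy in energy and satisfies the equation asymptotically
  (\<open>energy_minimizing_sequence\<close>), and all that is left is to pass to the limit. The limit exists because
  \<open>L\<^sup>2(v)\<close> and \<open>QL\<^sup>2\<close> are complete (\<open>square_int_complete\<close>), and it lies in \<open>QH\<^sub>0\<close> because that space is
  a closure.

  Uniqueness is coercivity applied to a difference of solutions
  (\<open>energy_orthogonal_imp_AE_zero\<close>).

  Two preparations carry this. The space \<open>QL\<^sup>2\<close> is defined through the positive semidefinite square
  root of \<open>Q\<close>, and the spectral theorem gives \<open>|\<surd>Q y|\<^sup>2 = y \<bullet> Q y\<close> (\<open>norm_psd_sqrt_mult\<close>). The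
  completeness of \<open>QL\<^sup>2\<close> cannot be deduced from that of an unweighted space by bounds on \<open>Q\<close>, since
  \<open>Q\<close> may degenerate and be unbounded; it rests on the pointwise definiteness of \<open>Q\<close> almost everywhere.
\<close>

section \<open>Square roots of positive semidefinite matrices\<close>

lemma symmetric_iff_self_adjoint:
  fixes A :: "real^'n^'n"
  shows "transpose A = A \<longleftrightarrow> (\<forall>x y. x \<bullet> (A *v y) = (A *v x) \<bullet> y)"
proof
  assume "transpose A = A"
  then show "\<forall>x y. x \<bullet> (A *v y) = (A *v x) \<bullet> y"
    by (metis dot_lmul_matrix inner_commute transpose_matrix_vector)
next
  assume *: "\<forall>x y. x \<bullet> (A *v y) = (A *v x) \<bullet> y"
  have "transpose A *v x = A *v x" for x
  proof -
    have "(transpose A *v x) \<bullet> y = (A *v x) \<bullet> y" for y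
      using * by (simp add: transpose_matrix_vector dot_lmul_matrix)
    then show ?thesis
      by (meson vector_eq_rdot)
  qed
  then show "transpose A = A"
    by (simp add: matrix_eq)
qed

text \<open>
  A maximum of the quadratic form on the unit sphere of an invariant subspace is an eigenvector:
  the residual \<open>r = A e - \<mu> e\<close> would otherwise be a direction of first-order increase.
\<close>

lemma symmetric_invariant_subspace_eigenvector:
  fixes A :: "real^'n^'n"
  assumes sym: "transpose A = A" and W: "subspace W" "W \<noteq> {0}"
    and inv: "\<And>x. x \<in> W \<Longrightarrow> A *v x \<in> W"
  obtains e \<mu> where "e \<in> W" "norm e = 1" "A *v e = \<mu> *\<^sub>R e"
proof -
  have sa: "x \<bullet> (A *v y) = (A *v x) \<bullet> y" for x y
    using sym symmetric_iff_self_adjoint by blast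
  obtain w where "w \<in> W" "w \<noteq> 0"
    using W subspace_0 by blast
  then have "w /\<^sub>R norm w \<in> sphere 0 1 \<inter> W"
    using W(1) by (simp add: subspace_scale)
  then have "sphere 0 1 \<inter> W \<noteq> {}"
    by blast
  moreover have "compact (sphere 0 1 \<inter> W)"
    by (simp add: W(1) closed_subspace compact_Int_closed)
  moreover have "continuous_on (sphere 0 1 \<inter> W) (\<lambda>x. x \<bullet> (A *v x))"
    by (intro continuous_intros linear_continuous_on linear_linear[THEN iffD1]
        matrix_vector_mul_linear)
  ultimately have "\<exists>e\<in>sphere 0 1 \<inter> W. \<forall>x\<in>sphere 0 1 \<inter> W. x \<bullet> (A *v x) \<le> e \<bullet> (A *v e)"
    using continuous_attains_sup by blast
  then obtain e where e: "e \<in> sphere 0 1 \<inter> W"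
    and max: "\<And>x. x \<in> sphere 0 1 \<inter> W \<Longrightarrow> x \<bullet> (A *v x) \<le> e \<bullet> (A *v e)"
    by blast
  define \<mu> where "\<mu> = e \<bullet> (A *v e)"
  have ee: "e \<bullet> e = 1"
    using e by (simp add: dot_square_norm)
  have le: "y \<bullet> (A *v y) \<le> \<mu> * (y \<bullet> y)" if "y \<in> W" for y
  proof (cases "y = 0")
    case False
    then have "y /\<^sub>R norm y \<in> sphere 0 1 \<inter> W"
      using W(1) that by (simp add: subspace_scale)
    from max[OF this] have "(y \<bullet> (A *v y)) / (norm y)\<^sup>2 \<le> \<mu>"
      by (simp add: \<mu>_def matrix_vector_mult_scaleR power2_eq_square field_simps)
    then show ?thesis
      using False by (simp add: dot_square_norm field_simps)
  qed simp
  define r where "r = A *v e - \<mu> *\<^sub>R e"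
  have rW: "r \<in> W"
    using e inv W(1) by (auto simp: r_def intro: subspace_diff subspace_scale)
  have er: "e \<bullet> r = 0" "r \<bullet> e = 0"
    by (auto simp: r_def inner_diff_right inner_diff_left \<mu>_def ee inner_commute)
  have Ae: "A *v e = r + \<mu> *\<^sub>R e"
    by (simp add: r_def)
  have rAe: "r \<bullet> (A *v e) = r \<bullet> r" "e \<bullet> (A *v r) = r \<bullet> r"
    unfolding sa[of e r] by (simp_all add: Ae inner_add_left inner_add_right er)
  define c where "c = \<mu> * (r \<bullet> r) - r \<bullet> (A *v r)"
  have c: "c \<ge> 0"
    using le[OF rW] by (simp add: c_def)
  have ineq: "2 * s * (r \<bullet> r) \<le> s\<^sup>2 * c" for s
  proof -
    have "e + s *\<^sub>R r \<in> W"
      using e rW W(1) by (auto intro: subspace_add subspace_scale)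
    from le[OF this] show ?thesis
      by (simp add: matrix_vector_right_distrib matrix_vector_mult_scaleR inner_add_left inner_add_right
          er ee rAe c_def \<mu>_def[symmetric] power2_eq_square algebra_simps)
  qed
  have "r \<bullet> r = 0"
  proof (rule ccontr)
    assume "r \<bullet> r \<noteq> 0"
    then have p: "0 < r \<bullet> r" by simp
    \<comment> \<open>at \<open>s = q\<close> the linear term on the left outweighs the quadratic one on the right\<close>
    define q where "q = (r \<bullet> r) / (c + 1)"
    have "q * (c + 1) = r \<bullet> r"
      using c by (simp add: q_def)
    then have q: "0 < q" "q * c + q = r \<bullet> r"
      using p c by (simp_all add: q_def distrib_left)
    have "q * (2 * (r \<bullet> r)) \<le> q * (q * c)"
      using ineq[of q] by (simp add: power2_eq_square mult_ac)
    then have "2 * (r \<bullet> r) \<le> q * c"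
      using q(1) by simp
    then show False using q p by linarith
  qed
  then have "A *v e = \<mu> *\<^sub>R e"
    by (simp add: r_def)
  then show ?thesis
    using that e by auto
qed

text \<open>
  A maximal orthonormal set of eigenvectors spans: its orthogonal complement is invariant, so if it
  were nonzero it would contain one more unit eigenvector.
\<close>

theorem symmetric_matrix_eigenbasis:
  fixes A :: "real^'n^'n"
  assumes sym: "transpose A = A"
  obtains S \<mu> where "finite S" "\<And>e. e \<in> S \<Longrightarrow> A *v e = \<mu> e *\<^sub>R e"
    "\<And>d e. d \<in> S \<Longrightarrow> e \<in> S \<Longrightarrow> d \<bullet> e = (if d = e then 1 else 0)"
    "\<And>x. x = (\<Sum>e\<in>S. (e \<bullet> x) *\<^sub>R e)"
proof -
  have sa: "x \<bullet> (A *v y) = (A *v x) \<bullet> y" for x y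
    using sym symmetric_iff_self_adjoint by blast
  define P where "P S \<longleftrightarrow> pairwise orthogonal S \<and> (\<forall>e\<in>S. norm e = 1 \<and> (\<exists>\<mu>. A *v e = \<mu> *\<^sub>R e))"
    for S :: "(real^'n) set"
  have indep: "independent S" if "P S" for S
    using that by (intro pairwise_orthogonal_independent) (auto simp: P_def)
  have bound: "\<forall>T. P T \<longrightarrow> card T < DIM(real^'n) + 1"
    using indep independent_bound less_Suc_eq_le by (metis Suc_eq_plus1)
  have "P {}"
    by (simp add: P_def)
  then have "\<exists>S. P S \<and> (\<forall>T. P T \<longrightarrow> card T \<le> card S)"
    using bound by (rule ex_has_greatest_nat)
  then obtain S where S: "P S" and max: "\<And>T. P T \<Longrightarrow> card T \<le> card S"
    by blast
  have fin: "finite S"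
    using indep[OF S] independent_bound by blast
  have orth: "d \<bullet> e = (if d = e then 1 else 0)" if "d \<in> S" "e \<in> S" for d e
    using S that by (auto simp: P_def pairwise_def orthogonal_def dot_square_norm)
  have "\<forall>e\<in>S. \<exists>\<mu>. A *v e = \<mu> *\<^sub>R e"
    using S by (auto simp: P_def)
  then obtain \<mu> where \<mu>: "\<And>e. e \<in> S \<Longrightarrow> A *v e = \<mu> e *\<^sub>R e"
    by metis
  define W where "W = {x. \<forall>e\<in>S. e \<bullet> x = 0}"
  have W: "subspace W"
    by (auto simp: W_def subspace_def inner_add_right)
  have "W = {0}"
  proof (rule ccontr)
    assume "W \<noteq> {0}"
    moreover have "A *v x \<in> W" if "x \<in> W" for x
      using that by (auto simp: W_def sa \<mu>)
    ultimately obtain e \<nu> where e: "e \<in> W" "norm e = 1" "A *v e = \<nu> *\<^sub>R e"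
      using symmetric_invariant_subspace_eigenvector[OF sym W] by metis
    have "e \<notin> S"
      using e by (auto simp: W_def)
    moreover have "P (insert e S)"
      using S e by (auto simp: P_def pairwise_insert orthogonal_def W_def inner_commute)
    ultimately show False
      using max[of "insert e S"] fin by simp
  qed
  have expand: "x = (\<Sum>e\<in>S. (e \<bullet> x) *\<^sub>R e)" for x
  proof -
    have "x - (\<Sum>e\<in>S. (e \<bullet> x) *\<^sub>R e) \<in> W"
      using fin by (auto simp: W_def inner_diff_right inner_sum_right orth if_distrib cong: if_cong)
    then show ?thesis
      unfolding \<open>W = {0}\<close> by simp
  qed
  show ?thesis
    using fin \<mu> orth expand by (rule that)
qed

text \<open>
  On an eigenvector \<open>e\<close> of \<open>A = B\<^sup>2\<close> a positive semidefinite \<open>B\<close> can only act as multiplication by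
  the root of the eigenvalue: \<open>w = B e - \<surd>\<mu> e\<close> satisfies \<open>B w = - \<surd>\<mu> w\<close>, which positivity
  excludes unless \<open>w = 0\<close> or \<open>\<mu> = 0\<close>, and in the latter case \<open>|B e|\<^sup>2 = e \<bullet> A e = 0\<close>. This is
  what makes the square root unique.
\<close>

lemma pos_semidef_root_eigenvector:
  fixes B :: "real^'n^'n"
  assumes B: "pos_semidef B" and e: "(B ** B) *v e = \<mu> *\<^sub>R e" and \<mu>: "0 \<le> \<mu>"
  shows "B *v e = sqrt \<mu> *\<^sub>R e"
proof -
  have BB: "B *v (B *v e) = \<mu> *\<^sub>R e"
    using e by (simp add: matrix_vector_mul_assoc)
  define w where "w = B *v e - sqrt \<mu> *\<^sub>R e"
  have "B *v w = - sqrt \<mu> *\<^sub>R w"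
    using \<mu> by (simp add: w_def matrix_vector_mult_diff_distrib matrix_vector_mult_scaleR BB algebra_simps)
  moreover have "0 \<le> w \<bullet> (B *v w)"
    using B by (simp add: pos_semidef_def)
  ultimately have *: "sqrt \<mu> * (w \<bullet> w) \<le> 0"
    by simp
  show ?thesis
  proof (cases "\<mu> = 0")
    case True
    have "(B *v e) \<bullet> (B *v e) = e \<bullet> (B *v (B *v e))"
      using B unfolding pos_semidef_def symmetric_iff_self_adjoint by simp
    with True BB show ?thesis by simp
  next
    case False
    with * \<mu> have "w \<bullet> w \<le> 0"
      by (simp add: mult_le_0_iff)
    then have "w = 0"
      by (metis inner_eq_zero_iff inner_ge_zero order_antisym)
    then show ?thesis by (simp add: w_def)
  qed
qed

text \<open>
  In an orthonormal eigenbasis the root takes the square roots of the eigenvalues; any other root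
  agrees with it on the basis. Both halves are needed because the square root is a definite
  description, of which nothing is known before existence and uniqueness are established.
\<close>

lemma ex1_pos_semidef_root:
  fixes A :: "real^'n^'n"
  assumes A: "pos_semidef A"
  shows "\<exists>!B. pos_semidef B \<and> B ** B = A"
proof -
  from A have sym: "transpose A = A" by (simp add: pos_semidef_def)
  obtain S \<mu> where fin: "finite S" and ev: "\<And>e. e \<in> S \<Longrightarrow> A *v e = \<mu> e *\<^sub>R e"
    and orth: "\<And>d e. d \<in> S \<Longrightarrow> e \<in> S \<Longrightarrow> d \<bullet> e = (if d = e then 1 else 0)"
    and expand: "\<And>x. x = (\<Sum>e\<in>S. (e \<bullet> x) *\<^sub>R e)"
    by (rule symmetric_matrix_eigenbasis[OF sym]) blast
  have nonneg: "0 \<le> \<mu> e" if "e \<in> S" for e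
  proof -
    have "0 \<le> e \<bullet> (A *v e)"
      using A by (simp add: pos_semidef_def)
    then show ?thesis
      using that by (simp add: ev orth)
  qed
  define T where "T x = (\<Sum>e\<in>S. (sqrt (\<mu> e) * (e \<bullet> x)) *\<^sub>R e)" for x
  have "linear T"
    unfolding T_def
    by (intro linearI) (simp_all add: inner_add_right distrib_left scaleR_left_distrib sum.distrib scaleR_sum_right mult.left_commute)
  then have T: "matrix T *v x = T x" for x
    by (simp add: matrix_works)
  have eT: "e \<bullet> T x = sqrt (\<mu> e) * (e \<bullet> x)" if "e \<in> S" for e x
    using fin that by (simp add: T_def inner_sum_right orth if_distrib cong: if_cong)
  have xT: "x \<bullet> T y = (\<Sum>e\<in>S. sqrt (\<mu> e) * ((e \<bullet> x) * (e \<bullet> y)))" for x y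
    by (simp add: T_def inner_sum_right inner_commute mult_ac)
  have "pos_semidef (matrix T)"
    unfolding pos_semidef_def symmetric_iff_self_adjoint
  proof (intro conjI allI)
    show "x \<bullet> (matrix T *v y) = (matrix T *v x) \<bullet> y" for x y
      by (simp add: T xT inner_commute[of "T x" y] mult_ac)
    show "0 \<le> x \<bullet> (matrix T *v x)" for x
      unfolding T xT by (rule sum_nonneg, rule mult_nonneg_nonneg) (simp_all add: nonneg)
  qed
  moreover have "matrix T ** matrix T = A"
    unfolding matrix_eq
  proof
    fix x
    have "T (T x) = (\<Sum>e\<in>S. (\<mu> e * (e \<bullet> x)) *\<^sub>R e)"
      unfolding T_def[of "T x"] using nonneg by (intro sum.cong) (auto simp: eT mult.assoc[symmetric])
    also have "\<dots> = (\<Sum>e\<in>S. (e \<bullet> x) *\<^sub>R (A *v e))"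
      by (intro sum.cong) (auto simp: ev)
    also have "\<dots> = A *v (\<Sum>e\<in>S. (e \<bullet> x) *\<^sub>R e)"
      by (simp add: matrix_vector_mult_scaleR linear_sum[OF matrix_vector_mul_linear])
    also have "\<dots> = A *v x"
      using expand[of x] by simp
    finally show "matrix T ** matrix T *v x = A *v x"
      by (simp add: matrix_vector_mul_assoc[symmetric] T)
  qed
  moreover have "B *v x = T x" if "pos_semidef B" "B ** B = A" for B x
  proof -
    have Be: "B *v e = sqrt (\<mu> e) *\<^sub>R e" if "e \<in> S" for e
      using \<open>pos_semidef B\<close> \<open>B ** B = A\<close> ev[OF that] nonneg[OF that]
      by (intro pos_semidef_root_eigenvector) simp_all
    have "B *v x = B *v (\<Sum>e\<in>S. (e \<bullet> x) *\<^sub>R e)"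
      using expand[of x] by simp
    also have "\<dots> = (\<Sum>e\<in>S. (e \<bullet> x) *\<^sub>R (B *v e))"
      by (simp add: matrix_vector_mult_scaleR linear_sum[OF matrix_vector_mul_linear])
    also have "\<dots> = T x"
      by (auto simp: T_def Be mult.commute intro!: sum.cong)
    finally show ?thesis .
  qed
  then have "B = matrix T" if "pos_semidef B" "B ** B = A" for B
    using that by (simp add: matrix_eq T)
  ultimately show ?thesis by metis
qed

lemma pos_semidef_psd_sqrt: "pos_semidef A \<Longrightarrow> pos_semidef (psd_sqrt A)"
  and psd_sqrt_square: "pos_semidef A \<Longrightarrow> psd_sqrt A ** psd_sqrt A = A"
  using theI'[OF ex1_pos_semidef_root] by (auto simp: psd_sqrt_def)

text \<open>
  This identity removes the square root from all that follows: \<open>y \<bullet> Q y\<close> is visibly measurable in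
  the entries of \<open>Q\<close> and polarises to the bilinear form of the equation.
\<close>

lemma norm_psd_sqrt_mult:
  assumes "pos_semidef A"
  shows "(norm (psd_sqrt A *v y))\<^sup>2 = y \<bullet> (A *v y)"
proof -
  have "(psd_sqrt A *v y) \<bullet> (psd_sqrt A *v y) = y \<bullet> (psd_sqrt A *v (psd_sqrt A *v y))"
    using pos_semidef_psd_sqrt[OF assms] unfolding pos_semidef_def symmetric_iff_self_adjoint by simp
  then show ?thesis
    by (simp add: matrix_vector_mul_assoc psd_sqrt_square[OF assms] power2_norm_eq_inner)
qed

lemma pos_semidef_invertible_definite:
  assumes A: "pos_semidef A" "invertible A" and 0: "y \<bullet> (A *v y) = 0"
  shows "y = 0"
proof -
  have "psd_sqrt A *v y = 0"
    using norm_psd_sqrt_mult[OF A(1), of y] 0 by simp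
  then have "A *v y = 0"
    using psd_sqrt_square[OF A(1)] by (metis matrix_vector_mul_assoc matrix_vector_mult_0_right)
  then show ?thesis
    using A(2) by (metis invertible_def matrix_left_invertible_ker)
qed

section \<open>Square integrability for a measurable field of inner products\<close>

text \<open>
  The two spaces \<open>L\<^sup>2(v,\<Omega>)\<close> and \<open>QL\<^sup>2(\<Omega>)\<close> are instances of one construction: the functions that are
  square integrable for an inner product on a Euclidean space that varies measurably with the point.
  Definiteness is demanded only almost everywhere, so \<open>Q\<close> may degenerate on a null set and have
  no uniform lower bound.
\<close>

locale inner_product_field =
  fixes M :: "'a measure"
    and A :: "'a \<Rightarrow> 'b::euclidean_space \<Rightarrow> 'b \<Rightarrow> real"
  assumes bilinear: "x \<in> space M \<Longrightarrow> bilinear (A x)"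
    and sym: "x \<in> space M \<Longrightarrow> A x y z = A x z y"
    and nonneg: "x \<in> space M \<Longrightarrow> 0 \<le> A x y y"
    and definite: "AE x in M. \<forall>y. A x y y = 0 \<longrightarrow> y = 0"
    and measurable_A [measurable]: "f \<in> borel_measurable M \<Longrightarrow> g \<in> borel_measurable M \<Longrightarrow>
      (\<lambda>x. A x (f x) (g x)) \<in> borel_measurable M"
begin

definition square_int :: "('a \<Rightarrow> 'b) set" where
  "square_int = {f \<in> borel_measurable M. integrable M (\<lambda>x. A x (f x) (f x))}"

definition ip :: "('a \<Rightarrow> 'b) \<Rightarrow> ('a \<Rightarrow> 'b) \<Rightarrow> real" where
  "ip f g = (LINT x|M. A x (f x) (g x))"

definition nrm :: "('a \<Rightarrow> 'b) \<Rightarrow> real" where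
  "nrm f = sqrt (ip f f)"

lemma A_expand:
  assumes "x \<in> space M"
  shows "A x (y + c *\<^sub>R z) w = A x y w + c * A x z w"
    and "A x w (y + c *\<^sub>R z) = A x w y + c * A x w z"
  using bilinear[OF assms]
  by (simp_all add: bilinear_ladd bilinear_radd bilinear_lmul bilinear_rmul)

lemma A_square:
  assumes "x \<in> space M"
  shows "A x (y + c *\<^sub>R z) (y + c *\<^sub>R z) = A x y y + 2 * c * A x y z + c\<^sup>2 * A x z z"
  using sym[OF assms, of z y] by (simp add: A_expand[OF assms] power2_eq_square algebra_simps)

lemma square_int_measurable: "f \<in> square_int \<Longrightarrow> f \<in> borel_measurable M"
  by (simp add: square_int_def)

lemma square_int_iff: "f \<in> square_int \<longleftrightarrow> f \<in> borel_measurable M \<and> (\<integral>\<^sup>+x. ennreal (A x (f x) (f x)) \<partial>M) < \<infinity>"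
proof -
  have "(\<integral>\<^sup>+x. ennreal (norm (A x (f x) (f x))) \<partial>M) = (\<integral>\<^sup>+x. ennreal (A x (f x) (f x)) \<partial>M)"
    by (intro nn_integral_cong) (simp add: nonneg)
  then show ?thesis
    by (auto simp: square_int_def integrable_iff_bounded)
qed

lemma nn_integral_eq_ip:
  assumes "f \<in> square_int"
  shows "(\<integral>\<^sup>+x. ennreal (A x (f x) (f x)) \<partial>M) = ennreal (ip f f)"
  unfolding ip_def using assms
  by (intro nn_integral_eq_integral) (auto simp: square_int_def intro!: AE_I2 nonneg)

lemma integrable_A:
  assumes f: "f \<in> square_int" and g: "g \<in> square_int"
  shows "integrable M (\<lambda>x. A x (f x) (g x))"
proof (rule Bochner_Integration.integrable_bound)
  show "integrable M (\<lambda>x. A x (f x) (f x) + A x (g x) (g x))"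
    using f g by (auto simp: square_int_def)
  show "(\<lambda>x. A x (f x) (g x)) \<in> borel_measurable M"
    using f g by (auto simp: square_int_def)
  have "\<bar>A x y z\<bar> \<le> A x y y + A x z z" if x: "x \<in> space M" for x y z
    using A_square[OF x, of y 1 z] A_square[OF x, of y "-1" z] nonneg[OF x, of "y + 1 *\<^sub>R z"]
      nonneg[OF x, of "y + (-1) *\<^sub>R z"] nonneg[OF x, of y] nonneg[OF x, of z]
    unfolding power2_eq_square by linarith
  then show "AE x in M. norm (A x (f x) (g x)) \<le> norm (A x (f x) (f x) + A x (g x) (g x))"
    by (intro AE_I2) (simp add: nonneg)
qed

lemma square_int_comb:
  assumes f: "f \<in> square_int" and g: "g \<in> square_int"
  shows "(\<lambda>x. f x + c *\<^sub>R g x) \<in> square_int"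
proof -
  have "integrable M (\<lambda>x. A x (f x) (f x) + 2 * c * A x (f x) (g x) + c\<^sup>2 * A x (g x) (g x))"
    using integrable_A assms by auto
  moreover have "(\<lambda>x. f x + c *\<^sub>R g x) \<in> borel_measurable M"
    using assms by (auto simp: square_int_def)
  ultimately show ?thesis
    by (simp add: square_int_def A_square cong: Bochner_Integration.integrable_cong)
qed

lemma square_int_diff: "f \<in> square_int \<Longrightarrow> g \<in> square_int \<Longrightarrow> (\<lambda>x. f x - g x) \<in> square_int"
  using square_int_comb[of f g "-1"] by simp

lemma ip_comb_left:
  assumes "f \<in> square_int" "g \<in> square_int" "h \<in> square_int"
  shows "ip (\<lambda>x. f x + c *\<^sub>R g x) h = ip f h + c * ip g h"
proof -
  have "ip (\<lambda>x. f x + c *\<^sub>R g x) h = (LINT x|M. A x (f x) (h x) + c * A x (g x) (h x))"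
    unfolding ip_def by (intro Bochner_Integration.integral_cong) (auto simp: A_expand)
  also have "\<dots> = ip f h + c * ip g h"
    using integrable_A assms by (simp add: ip_def)
  finally show ?thesis .
qed

lemma ip_sym: "ip f g = ip g f"
  unfolding ip_def by (intro Bochner_Integration.integral_cong) (auto simp: sym)

lemma ip_diff_left:
  assumes "f \<in> square_int" "g \<in> square_int" "h \<in> square_int"
  shows "ip (\<lambda>x. f x - g x) h = ip f h - ip g h"
  using ip_comb_left[OF assms, of "-1"] by simp

lemma ip_nonneg: "0 \<le> ip f f"
  unfolding ip_def by (intro integral_nonneg_AE AE_I2 nonneg)

lemma nrm_nonneg: "0 \<le> nrm f"
  by (simp add: nrm_def ip_nonneg)

lemma nrm_power2: "(nrm f)\<^sup>2 = ip f f"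
  by (simp add: nrm_def ip_nonneg)

lemma nrm_minus_commute: "nrm (\<lambda>x. f x - g x) = nrm (\<lambda>x. g x - f x)"
proof -
  have "A x (y - z) (y - z) = A x (z - y) (z - y)" if "x \<in> space M" for x y z
    using A_square[OF that, of y "-1" z] A_square[OF that, of z "-1" y] sym[OF that, of y z] by simp
  then show ?thesis
    by (auto simp: nrm_def ip_def intro!: Bochner_Integration.integral_cong)
qed

lemma ip_square:
  assumes "f \<in> square_int" "g \<in> square_int"
  shows "ip (\<lambda>x. f x + c *\<^sub>R g x) (\<lambda>x. f x + c *\<^sub>R g x) = ip f f + 2 * c * ip f g + c\<^sup>2 * ip g g"
  using assms ip_comb_left[OF assms square_int_comb[OF assms], of c c]
    ip_comb_left[OF assms assms(1), of c] ip_comb_left[OF assms assms(2), of c]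
    ip_sym[of f "\<lambda>x. f x + c *\<^sub>R g x"] ip_sym[of g "\<lambda>x. f x + c *\<^sub>R g x"] ip_sym[of g f]
  by (simp add: power2_eq_square algebra_simps)

lemma Cauchy_Schwarz_ip:
  assumes "f \<in> square_int" "g \<in> square_int"
  shows "\<bar>ip f g\<bar> \<le> nrm f * nrm g"
proof -
  have pos: "0 \<le> ip f f + 2 * c * ip f g + c\<^sup>2 * ip g g" for c
    using ip_square[OF assms, of c] ip_nonneg by metis
  have "(ip f g)\<^sup>2 \<le> ip f f * ip g g"
  proof (cases "ip g g = 0")
    case True
    have "ip f g = 0"
    proof (rule ccontr)
      assume "ip f g \<noteq> 0"
      then obtain c where c: "2 * c * ip f g = - (ip f f + 1)"
        using that[of "- (ip f f + 1) / (2 * ip f g)"] by simp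
      show False
        using pos[of c] unfolding True c by simp
    qed
    with True show ?thesis by simp
  next
    case False
    then have "0 < ip g g"
      using ip_nonneg[of g] by simp
    then show ?thesis
      using pos[of "- ip f g / ip g g"] by (simp add: power2_eq_square field_simps)
  qed
  then have "sqrt ((ip f g)\<^sup>2) \<le> sqrt (ip f f * ip g g)"
    by (rule real_sqrt_le_mono)
  then show ?thesis
    by (simp add: nrm_def real_sqrt_mult)
qed

lemma nrm_triangle:
  assumes "f \<in> square_int" "g \<in> square_int"
  shows "nrm (\<lambda>x. f x + g x) \<le> nrm f + nrm g"
proof (rule power2_le_imp_le)
  have "(nrm (\<lambda>x. f x + g x))\<^sup>2 = (nrm f)\<^sup>2 + 2 * ip f g + (nrm g)\<^sup>2"
    using ip_square[OF assms, of 1] by (simp add: nrm_power2)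
  also have "\<dots> \<le> (nrm f + nrm g)\<^sup>2"
    using Cauchy_Schwarz_ip[OF assms] by (simp add: power2_sum)
  finally show "(nrm (\<lambda>x. f x + g x))\<^sup>2 \<le> (nrm f + nrm g)\<^sup>2" .
qed (simp add: nrm_nonneg)

lemma nrm_eq_0_imp_AE:
  assumes f: "f \<in> square_int" and 0: "nrm f = 0"
  shows "AE x in M. f x = 0"
proof -
  have "ip f f = 0"
    using 0 by (simp add: nrm_def)
  then have "AE x in M. A x (f x) (f x) = 0"
    using f unfolding ip_def
    by (subst (asm) integral_nonneg_eq_0_iff_AE) (auto simp: square_int_def intro!: AE_I2 nonneg)
  with definite show ?thesis
    by eventually_elim auto
qed

text \<open>
  Finite dimension turns definiteness into a quantitative bound: the form is bounded below on the
  compact unit sphere.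
\<close>

lemma AE_lower_bound:
  "AE x in M. \<exists>c>0. \<forall>y. c * norm y \<le> sqrt (A x y y)"
  using definite AE_space
proof eventually_elim
  case (elim x)
  then have def: "0 < A x y y" if "y \<noteq> 0" for y
    using that nonneg[of x y] by (metis less_eq_real_def)
  have hom: "A x (r *\<^sub>R y) (r *\<^sub>R y) = r\<^sup>2 * A x y y" for r y
    using bilinear[OF elim(2)] by (simp add: bilinear_lmul bilinear_rmul power2_eq_square)
  have "bounded_bilinear (A x)"
    using bilinear[OF elim(2)] bilinear_conv_bounded_bilinear by blast
  then have "continuous_on (sphere 0 1) (\<lambda>y. A x y y)"
    by (rule bounded_bilinear.continuous_on) (auto intro: continuous_intros)
  moreover have "sphere (0::'b) 1 \<noteq> {}"
    by (metis nonempty_Basis norm_Basis ex_in_conv mem_sphere_0)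
  ultimately have "\<exists>e\<in>sphere 0 1. \<forall>y\<in>sphere 0 1. A x e e \<le> A x y y"
    using continuous_attains_inf[of "sphere (0::'b) 1" "\<lambda>y. A x y y"] by simp
  then obtain e where e: "norm e = 1" and min: "\<And>y. norm y = 1 \<Longrightarrow> A x e e \<le> A x y y"
    by (auto simp: sphere_def)
  have "sqrt (A x e e) * norm y \<le> sqrt (A x y y)" for y
  proof (cases "y = 0")
    case True
    then show ?thesis by (simp add: nonneg[OF elim(2)])
  next
    case False
    then have "A x e e \<le> A x ((1 / norm y) *\<^sub>R y) ((1 / norm y) *\<^sub>R y)"
      by (intro min) simp
    then have "A x e e * (norm y)\<^sup>2 \<le> A x y y"
      using False unfolding hom by (simp add: field_simps)
    then have "sqrt (A x e e * (norm y)\<^sup>2) \<le> sqrt (A x y y)"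
      by (rule real_sqrt_le_mono)
    then show ?thesis
      by (simp add: real_sqrt_mult)
  qed
  moreover have "0 < sqrt (A x e e)"
    using def[of e] e by (metis norm_zero real_sqrt_gt_0_iff zero_neq_one)
  ultimately show ?case
    by blast
qed

text \<open>
  A sequence whose increments have squared norms at most \<open>8\<^sup>-\<^sup>j\<close> converges pointwise almost
  everywhere: the weights \<open>4\<^sup>j\<close> leave the integrals summable, so almost everywhere the increments
  are \<open>O(2\<^sup>-\<^sup>j)\<close> in the pointwise norm.
\<close>

lemma rapidly_Cauchy_imp_AE_convergent:
  assumes f: "\<And>j. f j \<in> square_int"
    and rapid: "\<And>j. ip (\<lambda>x. f (Suc j) x - f j x) (\<lambda>x. f (Suc j) x - f j x) \<le> (1 / 8) ^ j"
  shows "AE x in M. convergent (\<lambda>j. f j x)"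
proof -
  define d where "d j x = f (Suc j) x - f j x" for j x
  have d: "d j \<in> square_int" for j
    unfolding d_def by (intro square_int_diff f)
  have [measurable]: "d j \<in> borel_measurable M" for j
    using d square_int_measurable by blast
  have "(\<integral>\<^sup>+x. (\<Sum>j. ennreal (4 ^ j * A x (d j x) (d j x))) \<partial>M)
      = (\<Sum>j. \<integral>\<^sup>+x. ennreal (4 ^ j * A x (d j x) (d j x)) \<partial>M)"
    by (rule nn_integral_suminf) measurable
  also have "\<dots> \<le> (\<Sum>j. ennreal ((1 / 2) ^ j))"
  proof (rule suminf_le)
    fix j
    have "(\<integral>\<^sup>+x. ennreal (4 ^ j * A x (d j x) (d j x)) \<partial>M)
        = (\<integral>\<^sup>+x. ennreal (4 ^ j) * ennreal (A x (d j x) (d j x)) \<partial>M)"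
      by (intro nn_integral_cong) (simp add: ennreal_mult nonneg)
    also have "\<dots> = ennreal (4 ^ j) * (\<integral>\<^sup>+x. ennreal (A x (d j x) (d j x)) \<partial>M)"
      by (rule nn_integral_cmult) measurable
    also have "\<dots> = ennreal (4 ^ j * ip (d j) (d j))"
      by (simp add: nn_integral_eq_ip d ennreal_mult ip_nonneg)
    also have "\<dots> \<le> ennreal (4 ^ j * (1 / 8) ^ j)"
      using rapid[of j] unfolding d_def by (intro ennreal_leI mult_left_mono) auto
    also have "4 ^ j * (1 / 8) ^ j = ((1 / 2) ^ j :: real)"
      by (simp flip: power_mult_distrib)
    finally show "(\<integral>\<^sup>+x. ennreal (4 ^ j * A x (d j x) (d j x)) \<partial>M) \<le> ennreal ((1 / 2) ^ j)" .
  qed auto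
  also have "\<dots> < \<infinity>"
    by (subst suminf_ennreal2) (auto simp: summable_geometric)
  finally have "AE x in M. (\<Sum>j. ennreal (4 ^ j * A x (d j x) (d j x))) \<noteq> \<infinity>"
    by (intro nn_integral_PInf_AE) auto
  with AE_lower_bound AE_space show ?thesis
  proof eventually_elim
    case (elim x)
    then obtain c where c: "c > 0" "\<And>y. c * norm y \<le> sqrt (A x y y)"
      by blast
    define K where "K = enn2real (\<Sum>j. ennreal (4 ^ j * A x (d j x) (d j x)))"
    have "norm (d j x) \<le> sqrt K / c * (1 / 2) ^ j" for j
    proof -
      have "ennreal (4 ^ j * A x (d j x) (d j x)) \<le> ennreal K"
        using sum_le_suminf[of "\<lambda>j. ennreal (4 ^ j * A x (d j x) (d j x))" "{j}"] elim
        by (simp add: K_def ennreal_enn2real_if)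
      then have "4 ^ j * A x (d j x) (d j x) \<le> K"
        by (simp add: K_def)
      then have "A x (d j x) (d j x) \<le> K * (1 / 4) ^ j"
        by (simp add: field_simps power_one_over)
      then have "sqrt (A x (d j x) (d j x)) \<le> sqrt (K * (1 / 4) ^ j)"
        by (rule real_sqrt_le_mono)
      also have "\<dots> = sqrt K * (1 / 2) ^ j"
        by (simp add: real_sqrt_mult real_sqrt_power real_sqrt_divide)
      finally have "c * norm (d j x) \<le> sqrt K * (1 / 2) ^ j"
        using c(2)[of "d j x"] by linarith
      then show ?thesis
        using c(1) by (simp add: field_simps)
    qed
    moreover have "summable (\<lambda>j. sqrt K / c * (1 / 2) ^ j)"
      by (rule summable_mult, rule summable_geometric) simp
    ultimately have "summable (\<lambda>j. d j x)"
      by (metis summable_comparison_test')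
    then have "convergent (\<lambda>n. \<Sum>j<n. d j x)"
      by (simp add: summable_iff_convergent)
    moreover have "(\<Sum>j<n. d j x) = f n x - f 0 x" for n
      using sum_lessThan_telescope[of "\<lambda>j. f j x" n] by (simp add: d_def)
    ultimately have "convergent (\<lambda>n. f n x - f 0 x)"
      by simp
    from convergent_add[OF this convergent_const[of "f 0 x"]] show ?case
      by simp
  qed
qed

text \<open>
  The Riesz-Fischer argument. No bound on the pointwise inner products that is uniform in the point
  is available, so convergence in norm comes from Fatou's lemma rather than from domination.
\<close>

theorem square_int_complete:
  assumes f: "\<And>n. f n \<in> square_int"
    and Cauchy: "\<And>e. 0 < e \<Longrightarrow> \<exists>N. \<forall>m\<ge>N. \<forall>n\<ge>N. nrm (\<lambda>x. f m x - f n x) < e"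
  obtains g where "g \<in> square_int" "(\<lambda>n. nrm (\<lambda>x. f n x - g x)) \<longlonglongrightarrow> 0"
proof -
  have "\<exists>N. \<forall>m\<ge>N. \<forall>n\<ge>N. nrm (\<lambda>x. f m x - f n x) < sqrt ((1 / 8) ^ j)" for j
    by (rule Cauchy) simp
  then obtain N where N: "\<And>j m n. N j \<le> m \<Longrightarrow> N j \<le> n \<Longrightarrow>
      nrm (\<lambda>x. f m x - f n x) < sqrt ((1 / 8) ^ j)"
    by metis
  \<comment> \<open>subsequence indices: monotone, at least \<open>j\<close>, and beyond the threshold \<open>N j\<close>\<close>
  define k where "k j = (\<Sum>i\<le>j. N i) + j" for j
  have kN: "N j \<le> k j" for j
    using member_le_sum[of j "{..j}" N] by (simp add: k_def)
  have kj: "j \<le> k j" and kS: "k j \<le> k (Suc j)" for j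
    by (auto simp: k_def)
  have conv: "AE x in M. convergent (\<lambda>j. f (k j) x)"
  proof (rule rapidly_Cauchy_imp_AE_convergent)
    fix j
    have "nrm (\<lambda>x. f (k (Suc j)) x - f (k j) x) < sqrt ((1 / 8) ^ j)"
      using kN[of j] kS[of j] by (intro N) auto
    then show "ip (\<lambda>x. f (k (Suc j)) x - f (k j) x) (\<lambda>x. f (k (Suc j)) x - f (k j) x) \<le> (1 / 8) ^ j"
      by (simp add: nrm_def)
  qed (rule f)
  define g where "g x = lim (\<lambda>j. f (k j) x)" for x
  have [measurable]: "f n \<in> borel_measurable M" for n
    using f square_int_measurable by blast
  have [measurable]: "g \<in> borel_measurable M"
    unfolding g_def by (rule borel_measurable_lim_metric) simp
  \<comment> \<open>for fixed \<open>m\<close>, Fatou's lemma applied to \<open>f m - f (k j)\<close> as \<open>j\<close> grows\<close>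
  have fatou: "(\<integral>\<^sup>+x. ennreal (A x (f m x - g x) (f m x - g x)) \<partial>M) \<le> ennreal (e\<^sup>2)"
    if e: "0 < e" and m: "\<And>n. n0 \<le> n \<Longrightarrow> nrm (\<lambda>x. f m x - f n x) < e" for m n0 e
  proof -
    have "AE x in M. (\<lambda>j. ennreal (A x (f m x - f (k j) x) (f m x - f (k j) x)))
        \<longlonglongrightarrow> ennreal (A x (f m x - g x) (f m x - g x))"
      using conv AE_space
    proof eventually_elim
      case (elim x)
      then have "(\<lambda>j. f (k j) x) \<longlonglongrightarrow> g x"
        by (simp add: convergent_LIMSEQ_iff g_def)
      then have "(\<lambda>j. f m x - f (k j) x) \<longlonglongrightarrow> f m x - g x"
        by (intro tendsto_intros)
      moreover have "bounded_bilinear (A x)"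
        using bilinear[OF elim(2)] bilinear_conv_bounded_bilinear by blast
      ultimately have "(\<lambda>j. A x (f m x - f (k j) x) (f m x - f (k j) x)) \<longlonglongrightarrow> A x (f m x - g x) (f m x - g x)"
        using bounded_bilinear.tendsto by blast
      then show ?case
        by (rule tendsto_ennrealI)
    qed
    then have "(\<integral>\<^sup>+x. ennreal (A x (f m x - g x) (f m x - g x)) \<partial>M)
        = (\<integral>\<^sup>+x. liminf (\<lambda>j. ennreal (A x (f m x - f (k j) x) (f m x - f (k j) x))) \<partial>M)"
      by (intro nn_integral_cong_AE, eventually_elim) (simp add: lim_imp_Liminf)
    also have "\<dots> \<le> liminf (\<lambda>j. \<integral>\<^sup>+x. ennreal (A x (f m x - f (k j) x) (f m x - f (k j) x)) \<partial>M)"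
      by (rule nn_integral_liminf) measurable
    also have "\<dots> \<le> ennreal (e\<^sup>2)"
    proof (rule Liminf_le)
      show "\<forall>\<^sub>F j in sequentially.
          (\<integral>\<^sup>+x. ennreal (A x (f m x - f (k j) x) (f m x - f (k j) x)) \<partial>M) \<le> ennreal (e\<^sup>2)"
        using eventually_ge_at_top[of n0]
      proof eventually_elim
        case (elim j)
        then have "nrm (\<lambda>x. f m x - f (k j) x) < e"
          using kj[of j] by (intro m) simp
        then have "ip (\<lambda>x. f m x - f (k j) x) (\<lambda>x. f m x - f (k j) x) \<le> e\<^sup>2"
          by (metis less_imp_le nrm_nonneg nrm_power2 power_mono)
        then show ?case
          by (simp add: nn_integral_eq_ip[OF square_int_diff[OF f f]] ennreal_leI)
      qed
    qed simp
    finally show ?thesis .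
  qed
  have fg: "(\<lambda>x. f m x - g x) \<in> square_int" "nrm (\<lambda>x. f m x - g x) \<le> e"
    if e: "0 < e" and m: "\<And>n. n0 \<le> n \<Longrightarrow> nrm (\<lambda>x. f m x - f n x) < e" for m n0 e
  proof -
    show mem: "(\<lambda>x. f m x - g x) \<in> square_int"
      using fatou[OF that] by (simp add: square_int_iff) (meson ennreal_less_top le_less_trans)
    have "(nrm (\<lambda>x. f m x - g x))\<^sup>2 \<le> e\<^sup>2"
      using fatou[OF that] by (simp add: nn_integral_eq_ip[OF mem] nrm_power2)
    then show "nrm (\<lambda>x. f m x - g x) \<le> e"
      using e by (auto intro: power2_le_imp_le[OF _ less_imp_le])
  qed
  obtain n1 where n1: "\<And>n. n1 \<le> n \<Longrightarrow> nrm (\<lambda>x. f n1 x - f n x) < 1"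
    using Cauchy[of 1] by auto
  have "(\<lambda>x. f n1 x - (f n1 x - g x)) \<in> square_int"
    by (intro square_int_diff f fg(1)[OF zero_less_one n1])
  then have "g \<in> square_int" by simp
  moreover have "(\<lambda>n. nrm (\<lambda>x. f n x - g x)) \<longlonglongrightarrow> 0"
  proof (rule LIMSEQ_I)
    fix r :: real assume r: "0 < r"
    then obtain n2 where n2: "\<And>m n. n2 \<le> m \<Longrightarrow> n2 \<le> n \<Longrightarrow> nrm (\<lambda>x. f m x - f n x) < r / 2"
      using Cauchy[of "r / 2"] by auto
    have "norm (nrm (\<lambda>x. f m x - g x) - 0) < r" if "n2 \<le> m" for m
    proof -
      have "nrm (\<lambda>x. f m x - g x) \<le> r / 2"
        using r by (intro fg(2)[OF _ n2[OF that]]) auto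
      then show ?thesis
        using r nrm_nonneg[of "\<lambda>x. f m x - g x"] by simp
    qed
    then show "\<exists>no. \<forall>n\<ge>no. norm (nrm (\<lambda>x. f n x - g x) - 0) < r"
      by blast
  qed
  ultimately show ?thesis
    using that by blast
qed

lemma nrm_tendsto:
  assumes f: "\<And>n. f n \<in> square_int" and g: "g \<in> square_int" and lim: "(\<lambda>n. nrm (\<lambda>x. f n x - g x)) \<longlonglongrightarrow> 0"
  shows "(\<lambda>n. nrm (f n)) \<longlonglongrightarrow> nrm g"
proof (rule Lim_null[THEN iffD2], rule Lim_null_comparison[OF _ lim], rule always_eventually, rule allI)
  fix n
  have "nrm (f n) \<le> nrm (\<lambda>x. f n x - g x) + nrm g"
    using nrm_triangle[OF square_int_diff[OF f g] g] by simp
  moreover have "nrm g \<le> nrm (\<lambda>x. f n x - g x) + nrm (f n)"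
    using nrm_triangle[OF square_int_diff[OF g f] f, of n n] nrm_minus_commute[of g "f n"] by simp
  ultimately show "norm (nrm (f n) - nrm g) \<le> nrm (\<lambda>x. f n x - g x)"
    by simp
qed

lemma ip_tendsto:
  assumes "\<And>n. f n \<in> square_int" "g \<in> square_int" "h \<in> square_int" and lim: "(\<lambda>n. nrm (\<lambda>x. f n x - g x)) \<longlonglongrightarrow> 0"
  shows "(\<lambda>n. ip (f n) h) \<longlonglongrightarrow> ip g h"
proof (rule Lim_null[THEN iffD2], rule Lim_null_comparison)
  show "\<forall>\<^sub>F n in sequentially. norm (ip (f n) h - ip g h) \<le> nrm (\<lambda>x. f n x - g x) * nrm h"
    using Cauchy_Schwarz_ip[OF square_int_diff[OF assms(1,2)] assms(3)] ip_diff_left[OF assms(1,2,3)] by simp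
  show "(\<lambda>n. nrm (\<lambda>x. f n x - g x) * nrm h) \<longlonglongrightarrow> 0"
    using tendsto_mult_right[OF lim, of "nrm h"] by simp
qed

end

section \<open>Minimizing sequences of quadratic functionals\<close>

text \<open>
  The direct method for the functional \<open>J w = B w w / 2 - L w\<close>, where \<open>comb s w z\<close> stands for
  \<open>w + s z\<close>. Boundedness of \<open>L\<close> in the energy norm bounds \<open>J\<close> below. The parallelogram law makes a
  minimizing sequence Cauchy in energy, and comparing \<open>J (w n)\<close> with \<open>J (w n + s z)\<close> for
  \<open>s = \<plusminus> 1 / sqrt (n + 1)\<close> shows that the sequence satisfies the Euler-Lagrange equation in the
  limit. The limit itself need not exist in \<open>S\<close>: here \<open>S\<close> consists of the Lipschitz functions, and
  the limit is taken later in the ambient Lebesgue spaces.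
\<close>

lemma energy_minimizing_sequence:
  fixes B :: "'a \<Rightarrow> 'a \<Rightarrow> real" and L :: "'a \<Rightarrow> real" and comb :: "real \<Rightarrow> 'a \<Rightarrow> 'a \<Rightarrow> 'a"
  assumes nonempty: "S \<noteq> {}"
    and comb: "\<And>s w z. w \<in> S \<Longrightarrow> z \<in> S \<Longrightarrow> comb s w z \<in> S"
    and B_comb: "\<And>s w z y. w \<in> S \<Longrightarrow> z \<in> S \<Longrightarrow> y \<in> S \<Longrightarrow> B (comb s w z) y = B w y + s * B z y"
    and B_sym: "\<And>w z. w \<in> S \<Longrightarrow> z \<in> S \<Longrightarrow> B w z = B z w"
    and B_nonneg: "\<And>w. w \<in> S \<Longrightarrow> 0 \<le> B w w"
    and L_comb: "\<And>s w z. w \<in> S \<Longrightarrow> z \<in> S \<Longrightarrow> L (comb s w z) = L w + s * L z"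
    and L_bound: "\<And>w. w \<in> S \<Longrightarrow> \<bar>L w\<bar> \<le> K * sqrt (B w w)"
  shows "\<exists>w::nat \<Rightarrow> 'a. (\<forall>n. w n \<in> S) \<and>
    (\<forall>e>0. \<exists>N. \<forall>m\<ge>N. \<forall>n\<ge>N. B (comb (-1) (w m) (w n)) (comb (-1) (w m) (w n)) < e) \<and>
    (\<forall>z\<in>S. (\<lambda>n. B (w n) z) \<longlonglongrightarrow> L z)"
proof -
  define J where "J w = B w w / 2 - L w" for w
  have B_comb': "B y (comb s w z) = B y w + s * B y z" if "w \<in> S" "z \<in> S" "y \<in> S" for s w z y
    using that by (simp add: B_sym[of y] comb B_comb)
  have J_comb: "J (comb s w z) = J w + s * (B w z - L z) + s\<^sup>2 / 2 * B z z"
    if "w \<in> S" "z \<in> S" for s w z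
    using that by (simp add: J_def comb B_comb B_comb' L_comb B_sym[of z w] power2_eq_square field_simps)
  have "- (K\<^sup>2 / 2) \<le> J w" if "w \<in> S" for w
  proof -
    have "0 \<le> (sqrt (B w w) - K)\<^sup>2"
      by simp
    then have "0 \<le> B w w - 2 * (K * sqrt (B w w)) + K\<^sup>2"
      using B_nonneg[OF that] by (simp add: power2_diff algebra_simps)
    then show ?thesis
      using L_bound[OF that] unfolding J_def by linarith
  qed
  then have bdd: "bdd_below (J ` S)"
    by (intro bdd_belowI[of _ "- (K\<^sup>2 / 2)"]) auto
  define \<mu> where "\<mu> = Inf (J ` S)"
  have \<mu>: "\<mu> \<le> J w" if "w \<in> S" for w
    using that bdd by (auto simp: \<mu>_def intro: cInf_lower)
  have "\<exists>w\<in>S. J w < \<mu> + 1 / real (Suc n)" for n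
    using cInf_lessD[of "J ` S" "\<mu> + 1 / real (Suc n)"] nonempty by (auto simp: \<mu>_def)
  then obtain w where w: "w n \<in> S" and J_w: "J (w n) < \<mu> + 1 / real (Suc n)" for n
    by metis
  \<comment> \<open>the parallelogram law, applied to the midpoint of \<open>w m\<close> and \<open>w n\<close>\<close>
  have gap: "B (comb (-1) (w m) (w n)) (comb (-1) (w m) (w n)) \<le> 4 * (1 / real (Suc m) + 1 / real (Suc n))"
    for m n
  proof -
    define d where "d = comb (-1) (w m) (w n)"
    have d: "d \<in> S"
      using w comb by (simp add: d_def)
    have Bdd: "B d d = B (w m) (w m) - 2 * B (w n) (w m) + B (w n) (w n)"
      using w by (simp add: d_def B_comb B_comb' comb B_sym[of "w m" "w n"])
    have "B (w n) d = B (w n) (w m) - B (w n) (w n)" "L d = L (w m) - L (w n)"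
      using w by (simp_all add: d_def B_comb' L_comb)
    then have "J (w m) + J (w n) - 2 * J (comb (1 / 2) (w n) d) = B d d / 4"
      using w d by (simp add: J_comb) (simp add: J_def Bdd power2_eq_square field_simps)
    moreover have "\<mu> \<le> J (comb (1 / 2) (w n) d)"
      using w d comb \<mu> by blast
    ultimately show ?thesis
      using J_w[of m] J_w[of n] unfolding d_def by argo
  qed
  have inv_lim: "(\<lambda>n. 1 / real (Suc n)) \<longlonglongrightarrow> 0"
    using LIMSEQ_inverse_real_of_nat by (simp add: inverse_eq_divide)
  have "\<exists>N. \<forall>m\<ge>N. \<forall>n\<ge>N. B (comb (-1) (w m) (w n)) (comb (-1) (w m) (w n)) < e" if e: "0 < e" for e
  proof -
    have "\<exists>N. \<forall>n\<ge>N. norm (1 / real (Suc n) - 0) < e / 8"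
      using e by (intro LIMSEQ_D[OF inv_lim]) simp
    then obtain N where N: "\<And>n. N \<le> n \<Longrightarrow> 1 / real (Suc n) < e / 8"
      by auto
    have "B (comb (-1) (w m) (w n)) (comb (-1) (w m) (w n)) < e" if "N \<le> m" "N \<le> n" for m n
      using gap[of m n] N[OF that(1)] N[OF that(2)] by argo
    then show ?thesis
      by blast
  qed
  moreover have "(\<lambda>n. B (w n) z) \<longlonglongrightarrow> L z" if z: "z \<in> S" for z
  proof (rule Lim_null[THEN iffD2], rule Lim_null_comparison, rule always_eventually, rule allI)
    fix n
    define r where "r = sqrt (1 / real (Suc n))"
    have r: "0 < r" "r\<^sup>2 = 1 / real (Suc n)"
      by (simp_all add: r_def)
    have "0 \<le> s * (B (w n) z - L z) + s\<^sup>2 / 2 * B z z + r\<^sup>2" for s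
      using \<mu>[OF comb[OF w[of n] z, of s]] J_w[of n] r(2) by (simp add: J_comb w z)
    from this[of r] this[of "- r"]
    have "r * \<bar>B (w n) z - L z\<bar> \<le> r * (r * (1 + B z z / 2))"
      by (auto simp: abs_if power2_eq_square algebra_simps)
    then have "\<bar>B (w n) z - L z\<bar> \<le> r * (1 + B z z / 2)"
      using r(1) by simp
    then show "norm (B (w n) z - L z) \<le> sqrt (1 / real (Suc n)) * (1 + B z z / 2)"
      by (simp add: r_def)
  next
    show "(\<lambda>n. sqrt (1 / real (Suc n)) * (1 + B z z / 2)) \<longlonglongrightarrow> 0"
      using tendsto_mult_right[OF tendsto_real_sqrt[OF inv_lim], of "1 + B z z / 2"] by simp
  qed
  ultimately show ?thesis
    using w by blast
qed

section \<open>The two Lebesgue spaces as fields of inner products\<close>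

lemma inner_product_field_real: "inner_product_field M (\<lambda>_ y z. y * z :: real)"
  by standard (auto simp: bilinear_def linear_iff algebra_simps)

lemma borel_measurable_matrix_form:
  fixes Q :: "'a \<Rightarrow> real^'n^'n"
  assumes Q: "\<And>i j. (\<lambda>x. Q x $ i $ j) \<in> borel_measurable M"
    and f: "f \<in> borel_measurable M" and g: "g \<in> borel_measurable M"
  shows "(\<lambda>x. f x \<bullet> (Q x *v g x)) \<in> borel_measurable M"
proof -
  have component: "(\<lambda>x. h x $ i) \<in> borel_measurable M" if "h \<in> borel_measurable M"
    for h :: "'a \<Rightarrow> real^'n" and i
    using that unfolding cart_eq_inner_axis by measurable
  show ?thesis
    unfolding inner_vec_def matrix_vector_mult_def
    using Q component[OF f] component[OF g] by simp
qed

lemma inner_product_field_matrix_function: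
  fixes Q :: "real^'n \<Rightarrow> real^'n^'n"
  assumes \<Omega>: "\<Omega> \<in> sets lebesgue" and Q: "matrix_function \<Omega> Q"
  shows "inner_product_field (lebesgue_on \<Omega>) (\<lambda>x y z. y \<bullet> (Q x *v z))"
proof
  fix x y z assume "x \<in> space (lebesgue_on \<Omega>)"
  then have psd: "pos_semidef (Q x)"
    using Q by (simp add: matrix_function_def)
  show "bilinear (\<lambda>y z. y \<bullet> (Q x *v z))"
    by (auto simp: bilinear_def linear_iff inner_add_left inner_add_right
        matrix_vector_right_distrib matrix_vector_mult_scaleR)
  show "y \<bullet> (Q x *v z) = z \<bullet> (Q x *v y)"
    using psd symmetric_iff_self_adjoint by (metis inner_commute pos_semidef_def)
  show "0 \<le> y \<bullet> (Q x *v y)"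
    using psd by (simp add: pos_semidef_def)
next
  have "AE x in lebesgue_on \<Omega>. invertible (Q x)"
    using Q by (simp add: matrix_function_def)
  then show "AE x in lebesgue_on \<Omega>. \<forall>y. y \<bullet> (Q x *v y) = 0 \<longrightarrow> y = 0"
    using AE_space
  proof eventually_elim
    case (elim x)
    then show ?case
      using Q pos_semidef_invertible_definite by (auto simp: matrix_function_def)
  qed
next
  fix f g :: "real^'n \<Rightarrow> real^'n"
  assume "f \<in> borel_measurable (lebesgue_on \<Omega>)" "g \<in> borel_measurable (lebesgue_on \<Omega>)"
  then show "(\<lambda>x. f x \<bullet> (Q x *v g x)) \<in> borel_measurable (lebesgue_on \<Omega>)"
    using Q by (intro borel_measurable_matrix_form) (auto simp: matrix_function_def)
qed

lemma L2_component:
  fixes g :: "'a \<Rightarrow> real^'N"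
  assumes "g \<in> L2 M"
  shows "(\<lambda>x. g x $ i) \<in> L2 M"
proof -
  have "g \<in> borel_measurable M"
    using assms by (simp add: L2_def)
  then have "(\<lambda>x. g x $ i) \<in> borel_measurable M"
    unfolding cart_eq_inner_axis by measurable
  moreover have "(\<integral>\<^sup>+x. ennreal ((norm (g x $ i))\<^sup>2) \<partial>M) \<le> (\<integral>\<^sup>+x. ennreal ((norm (g x))\<^sup>2) \<partial>M)"
    by (intro nn_integral_mono ennreal_leI power_mono) (auto simp: component_le_norm_cart)
  ultimately show ?thesis
    using assms by (auto simp: L2_def intro: le_less_trans)
qed

lemma Linfty_AE_bound:
  assumes "F \<in> Linfty M"
  obtains K where "AE x in M. \<bar>F x\<bar> \<le> K"
proof -
  have "esssup M (\<lambda>x. ereal \<bar>F x\<bar>) < \<infinity>"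
    using assms by (simp add: Linfty_def)
  then obtain K :: nat where K: "esssup M (\<lambda>x. ereal \<bar>F x\<bar>) < ereal K"
    by (auto simp: less_PInf_Ex_of_nat)
  have "AE x in M. \<bar>F x\<bar> \<le> K"
    using esssup_AE[of "\<lambda>x. ereal \<bar>F x\<bar>" M]
  proof eventually_elim
    case (elim x)
    then have "ereal \<bar>F x\<bar> < ereal K"
      using K by (rule le_less_trans)
    then show ?case
      by simp
  qed
  then show ?thesis
    using that by blast
qed

section \<open>Linear combinations of Lipschitz pairs\<close>

definition comb :: "real \<Rightarrow> ('a \<Rightarrow> 'b::real_vector) \<times> ('a \<Rightarrow> 'c::real_vector) \<Rightarrow>
    ('a \<Rightarrow> 'b) \<times> ('a \<Rightarrow> 'c) \<Rightarrow> ('a \<Rightarrow> 'b) \<times> ('a \<Rightarrow> 'c)" where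
  "comb s w z = (\<lambda>x. fst w x + s *\<^sub>R fst z x, \<lambda>x. snd w x + s *\<^sub>R snd z x)"

lemma comb_minus_1: "comb (-1) w z = (\<lambda>x. fst w x - fst z x, \<lambda>x. snd w x - snd z x)"
  by (simp add: comb_def)

lemma Lip_0_comb:
  assumes u: "u \<in> Lip_0 \<Omega>" and \<phi>: "\<phi> \<in> Lip_0 \<Omega>"
  shows "(\<lambda>x. u x + s *\<^sub>R \<phi> x) \<in> Lip_0 \<Omega>"
proof -
  let ?f = "\<lambda>x. u x + s *\<^sub>R \<phi> x"
  obtain C D where "C-lipschitz_on \<Omega> u" "D-lipschitz_on \<Omega> \<phi>"
    using u \<phi> by (auto simp: Lip_0_def)
  then have "(C + \<bar>s\<bar> * D)-lipschitz_on \<Omega> ?f"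
    by (intro lipschitz_on_add lipschitz_on_cmult)
  moreover have sub: "closure (support_on \<Omega> ?f) \<subseteq> closure (support_on \<Omega> u) \<union> closure (support_on \<Omega> \<phi>)"
    unfolding closure_Un[symmetric] by (intro closure_mono) (auto simp: support_on_def)
  moreover have "compact (closure (support_on \<Omega> u) \<union> closure (support_on \<Omega> \<phi>))"
    using u \<phi> by (auto simp: Lip_0_def)
  then have "compact (closure (support_on \<Omega> ?f))"
    using sub by (meson closed_closure compact_eq_bounded_closed bounded_subset)
  moreover have "closure (support_on \<Omega> u) \<union> closure (support_on \<Omega> \<phi>) \<subseteq> \<Omega>"
    using u \<phi> by (auto simp: Lip_0_def)
  ultimately show ?thesis
    unfolding Lip_0_def by blast
qed

lemma is_gradient_comb:
  assumes "is_gradient \<Omega> u h" "is_gradient \<Omega> \<phi> k"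
  shows "is_gradient \<Omega> (\<lambda>x. u x + s *\<^sub>R \<phi> x) (\<lambda>x. h x + s *\<^sub>R k x)"
  using assms unfolding is_gradient_def
proof eventually_elim
  case (elim x)
  have "GDERIV (\<lambda>x. s * \<phi> x) x :> s *\<^sub>R k x + \<phi> x *\<^sub>R 0"
    by (intro GDERIV_mult GDERIV_const elim)
  with elim(1) show ?case
    using GDERIV_add by fastforce
qed

section \<open>The closure of the Lipschitz pairs\<close>

locale degenerate_Dirichlet =
  fixes \<Omega> :: "(real^'n) set"
    and v :: "real^'n \<Rightarrow> ennreal"
    and Q :: "real^'n \<Rightarrow> real^'n^'n"
    and F :: "real^'n \<Rightarrow> real"
  assumes open_\<Omega>: "open \<Omega>"
    and weight: "weight \<Omega> v"
    and matrix_function: "matrix_function \<Omega> Q"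
    and nonempty: "QLip_0 \<Omega> v Q \<noteq> {}"
    and poincare: "\<exists>C. \<forall>(\<phi>, h)\<in>QLip_0 \<Omega> v Q. L2_norm (weighted \<Omega> v) \<phi> \<le> C * QL2_norm \<Omega> Q h"
    and F_Linfty: "F \<in> Linfty (weighted \<Omega> v)"
    and F_nonneg: "AE x in weighted \<Omega> v. 0 \<le> F x"
begin

abbreviation (input) "M \<equiv> weighted \<Omega> v"

abbreviation (input) "S \<equiv> QLip_0 \<Omega> v Q"

sublocale V: inner_product_field "weighted \<Omega> v" "\<lambda>_ y z. y * z :: real"
  by (rule inner_product_field_real)

sublocale G: inner_product_field "lebesgue_on \<Omega>" "\<lambda>x y z. y \<bullet> (Q x *v z)"
  using open_\<Omega> matrix_function by (intro inner_product_field_matrix_function) auto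

lemma L2_eq: "L2 M = V.square_int"
  by (auto simp: L2_def V.square_int_iff power2_eq_square)

lemma L2_norm_eq: "L2_norm M u = V.nrm u"
  by (simp add: L2_norm_def V.nrm_def V.ip_def power2_eq_square)

lemma norm_sqrt_Q: "x \<in> \<Omega> \<Longrightarrow> (norm (psd_sqrt (Q x) *v y))\<^sup>2 = y \<bullet> (Q x *v y)"
  using matrix_function by (simp add: matrix_function_def norm_psd_sqrt_mult)

lemma QL2_eq: "QL2 \<Omega> Q = G.square_int"
proof -
  have "(\<integral>\<^sup>+x. ennreal ((norm (psd_sqrt (Q x) *v g x))\<^sup>2) \<partial>lebesgue_on \<Omega>)
      = (\<integral>\<^sup>+x. ennreal (g x \<bullet> (Q x *v g x)) \<partial>lebesgue_on \<Omega>)" for g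
    by (intro nn_integral_cong) (simp add: norm_sqrt_Q)
  then show ?thesis
    by (auto simp: QL2_def G.square_int_iff)
qed

lemma QL2_norm_eq: "QL2_norm \<Omega> Q g = G.nrm g"
proof -
  have "(LINT x|lebesgue_on \<Omega>. (norm (psd_sqrt (Q x) *v g x))\<^sup>2) = G.ip g g"
    unfolding G.ip_def by (intro Bochner_Integration.integral_cong) (simp_all add: norm_sqrt_Q)
  then show ?thesis
    by (simp add: QL2_norm_def G.nrm_def)
qed

lemma QH_norm_eq: "QH_norm \<Omega> v Q u g = V.nrm u + G.nrm g"
  by (simp add: QH_norm_def L2_norm_eq QL2_norm_eq)

lemma QLip_0_square_int: "w \<in> S \<Longrightarrow> fst w \<in> V.square_int" "w \<in> S \<Longrightarrow> snd w \<in> G.square_int"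
  by (auto simp: QLip_0_def L2_eq QL2_eq)

lemma QLip_0_comb: "w \<in> S \<Longrightarrow> z \<in> S \<Longrightarrow> comb s w z \<in> S"
  using Lip_0_comb is_gradient_comb V.square_int_comb G.square_int_comb
  by (fastforce simp: QLip_0_def comb_def L2_eq QL2_eq)

text \<open>
  The subunit estimate is available on \<open>QH\<close>, the closure of the locally Lipschitz pairs; this
  inclusion makes it applicable to test functions.
\<close>

lemma QLip_0_subset_QH: "S \<subseteq> QH \<Omega> v Q"
proof
  fix w assume "w \<in> S"
  then obtain \<phi> h where w: "w = (\<phi>, h)" "(\<phi>, h) \<in> S"
    by (cases w) auto
  then obtain C where "C-lipschitz_on \<Omega> \<phi>"
    by (auto simp: QLip_0_def Lip_0_def)
  then have "\<phi> \<in> Lip_loc \<Omega>"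
    using lipschitz_on_subset unfolding Lip_loc_def by blast
  then have "(\<phi>, h) \<in> QLip_loc \<Omega> v Q"
    using w(2) by (simp add: QLip_loc_def QLip_0_def)
  moreover have "QH_norm \<Omega> v Q (\<lambda>x. \<phi> x - \<phi> x) (\<lambda>x. h x - h x) = 0"
    by (simp add: QH_norm_eq V.nrm_def V.ip_def G.nrm_def G.ip_def)
  ultimately show "w \<in> QH \<Omega> v Q"
    using w(2) unfolding w(1) QH_def QH_closure_def QLip_0_def
    by (clarsimp, intro bexI[of _ "(\<phi>, h)"]) simp_all
qed

text \<open>
  Membership in the closure in terms of convergent sequences of pairs, one norm per component. This
  is the form in which the limit of a minimizing sequence arrives and in which limits are taken.
\<close>

lemma QH_0_I:
  assumes w: "\<And>n. w n \<in> S" and u: "u \<in> V.square_int" and g: "g \<in> G.square_int"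
    and "(\<lambda>n. V.nrm (\<lambda>x. fst (w n) x - u x)) \<longlonglongrightarrow> 0"
    and "(\<lambda>n. G.nrm (\<lambda>x. snd (w n) x - g x)) \<longlonglongrightarrow> 0"
  shows "(u, g) \<in> QH_0 \<Omega> v Q"
proof -
  have lim: "(\<lambda>n. V.nrm (\<lambda>x. fst (w n) x - u x) + G.nrm (\<lambda>x. snd (w n) x - g x)) \<longlonglongrightarrow> 0"
    using tendsto_add[OF assms(4,5)] by simp
  have "\<exists>(\<phi>, h)\<in>S. QH_norm \<Omega> v Q (\<lambda>x. u x - \<phi> x) (\<lambda>x. g x - h x) < \<epsilon>" if "0 < \<epsilon>" for \<epsilon>
  proof -
    obtain n where "V.nrm (\<lambda>x. fst (w n) x - u x) + G.nrm (\<lambda>x. snd (w n) x - g x) < \<epsilon>"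
      using order_tendstoD(2)[OF lim \<open>0 < \<epsilon>\<close>] eventually_sequentially by auto
    then show ?thesis
      using w[of n] by (intro bexI[of _ "w n"])
        (auto simp: QH_norm_eq V.nrm_minus_commute[of u] G.nrm_minus_commute[of g] case_prod_beta)
  qed
  then show ?thesis
    using u g by (simp add: QH_0_def QH_closure_def L2_eq QL2_eq)
qed

lemma QH_0_E:
  assumes "(u, g) \<in> QH_0 \<Omega> v Q"
  obtains w where "u \<in> V.square_int" "g \<in> G.square_int" "\<And>n::nat. w n \<in> S"
    "(\<lambda>n. V.nrm (\<lambda>x. fst (w n) x - u x)) \<longlonglongrightarrow> 0"
    "(\<lambda>n. G.nrm (\<lambda>x. snd (w n) x - g x)) \<longlonglongrightarrow> 0"
proof -
  have "\<forall>n. \<exists>w. w \<in> S \<and> V.nrm (\<lambda>x. u x - fst w x) + G.nrm (\<lambda>x. g x - snd w x) < 1 / real (Suc n)"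
  proof
    fix n
    have "\<exists>(\<phi>, h)\<in>S. QH_norm \<Omega> v Q (\<lambda>x. u x - \<phi> x) (\<lambda>x. g x - h x) < 1 / real (Suc n)"
      using assms by (simp add: QH_0_def QH_closure_def)
    then obtain \<phi> h where "(\<phi>, h) \<in> S" "QH_norm \<Omega> v Q (\<lambda>x. u x - \<phi> x) (\<lambda>x. g x - h x) < 1 / real (Suc n)"
      by blast
    then show "\<exists>w. w \<in> S \<and> V.nrm (\<lambda>x. u x - fst w x) + G.nrm (\<lambda>x. g x - snd w x) < 1 / real (Suc n)"
      unfolding QH_norm_eq by (intro exI[of _ "(\<phi>, h)"]) simp
  qed
  from choice[OF this] obtain w where w: "w n \<in> S"
    and less: "V.nrm (\<lambda>x. u x - fst (w n) x) + G.nrm (\<lambda>x. g x - snd (w n) x) < 1 / real (Suc n)" for n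
    by blast
  have inv_lim: "(\<lambda>n. 1 / real (Suc n)) \<longlonglongrightarrow> 0"
    using LIMSEQ_inverse_real_of_nat by (simp add: inverse_eq_divide)
  have le: "norm (V.nrm (\<lambda>x. fst (w n) x - u x)) \<le> 1 / real (Suc n)"
    "norm (G.nrm (\<lambda>x. snd (w n) x - g x)) \<le> 1 / real (Suc n)" for n
    using less[of n] V.nrm_nonneg[of "\<lambda>x. u x - fst (w n) x"] G.nrm_nonneg[of "\<lambda>x. g x - snd (w n) x"]
    unfolding V.nrm_minus_commute[of u] G.nrm_minus_commute[of g] real_norm_def by linarith+
  have "(\<lambda>n. V.nrm (\<lambda>x. fst (w n) x - u x)) \<longlonglongrightarrow> 0"
    "(\<lambda>n. G.nrm (\<lambda>x. snd (w n) x - g x)) \<longlonglongrightarrow> 0"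
    by (rule Lim_null_comparison[OF always_eventually[OF allI] inv_lim], rule le)+
  moreover have "u \<in> V.square_int" "g \<in> G.square_int"
    using assms by (auto simp: QH_0_def QH_closure_def L2_eq QL2_eq)
  ultimately show ?thesis
    using that w by blast
qed

lemma QH_0_diff:
  assumes "(u, g) \<in> QH_0 \<Omega> v Q" "(u', g') \<in> QH_0 \<Omega> v Q"
  shows "(\<lambda>x. u x - u' x, \<lambda>x. g x - g' x) \<in> QH_0 \<Omega> v Q"
proof -
  obtain w where u: "u \<in> V.square_int" "g \<in> G.square_int" and w: "\<And>n::nat. w n \<in> S"
    "(\<lambda>n. V.nrm (\<lambda>x. fst (w n) x - u x)) \<longlonglongrightarrow> 0" "(\<lambda>n. G.nrm (\<lambda>x. snd (w n) x - g x)) \<longlonglongrightarrow> 0"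
    using QH_0_E[OF assms(1)] by blast
  obtain w' where u': "u' \<in> V.square_int" "g' \<in> G.square_int" and w': "\<And>n::nat. w' n \<in> S"
    "(\<lambda>n. V.nrm (\<lambda>x. fst (w' n) x - u' x)) \<longlonglongrightarrow> 0" "(\<lambda>n. G.nrm (\<lambda>x. snd (w' n) x - g' x)) \<longlonglongrightarrow> 0"
    using QH_0_E[OF assms(2)] by blast
  note H = QLip_0_square_int[OF w(1)] QLip_0_square_int[OF w'(1)]
  have V_le: "V.nrm (\<lambda>x. fst (comb (-1) (w n) (w' n)) x - (u x - u' x))
      \<le> V.nrm (\<lambda>x. fst (w n) x - u x) + V.nrm (\<lambda>x. fst (w' n) x - u' x)" for n
    using V.nrm_triangle[OF V.square_int_diff[OF H(1)[of n] u(1)] V.square_int_diff[OF u'(1) H(3)[of n]]]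
    by (simp add: comb_minus_1 V.nrm_minus_commute[of u'] algebra_simps)
  have G_le: "G.nrm (\<lambda>x. snd (comb (-1) (w n) (w' n)) x - (g x - g' x))
      \<le> G.nrm (\<lambda>x. snd (w n) x - g x) + G.nrm (\<lambda>x. snd (w' n) x - g' x)" for n
    using G.nrm_triangle[OF G.square_int_diff[OF H(2)[of n] u(2)] G.square_int_diff[OF u'(2) H(4)[of n]]]
    by (simp add: comb_minus_1 G.nrm_minus_commute[of g'] algebra_simps)
  show ?thesis
  proof (rule QH_0_I[where w = "\<lambda>n. comb (-1) (w n) (w' n)"])
    show "(\<lambda>n. V.nrm (\<lambda>x. fst (comb (-1) (w n) (w' n)) x - (u x - u' x))) \<longlonglongrightarrow> 0"
      using V_le V.nrm_nonneg by (intro Lim_null_comparison[OF always_eventually tendsto_add_zero[OF w(2) w'(2)]]) simp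
    show "(\<lambda>n. G.nrm (\<lambda>x. snd (comb (-1) (w n) (w' n)) x - (g x - g' x))) \<longlonglongrightarrow> 0"
      using G_le G.nrm_nonneg by (intro Lim_null_comparison[OF always_eventually tendsto_add_zero[OF w(3) w'(3)]]) simp
  qed (auto intro: QLip_0_comb w w' V.square_int_diff G.square_int_diff u u')
qed

text \<open>
  Both sides of the Poincare inequality are continuous, so it passes to the closure. The constant is
  made nonnegative for use in later monotonicity steps.
\<close>

lemma QH_0_poincare:
  obtains C where "0 \<le> C" "\<And>w. w \<in> S \<Longrightarrow> V.nrm (fst w) \<le> C * G.nrm (snd w)"
    "\<And>u g. (u, g) \<in> QH_0 \<Omega> v Q \<Longrightarrow> V.nrm u \<le> C * G.nrm g"
proof -
  obtain C where C: "\<And>w. w \<in> S \<Longrightarrow> V.nrm (fst w) \<le> C * G.nrm (snd w)"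
    using poincare by (force simp: L2_norm_eq QL2_norm_eq)
  have le: "V.nrm (fst w) \<le> \<bar>C\<bar> * G.nrm (snd w)" if "w \<in> S" for w
    using C[OF that] G.nrm_nonneg[of "snd w"] mult_right_mono[OF abs_ge_self[of C]] by (meson order_trans)
  moreover have "V.nrm u \<le> \<bar>C\<bar> * G.nrm g" if ug: "(u, g) \<in> QH_0 \<Omega> v Q" for u g
  proof -
    obtain w where u: "u \<in> V.square_int" "g \<in> G.square_int" and w: "\<And>n::nat. w n \<in> S"
      "(\<lambda>n. V.nrm (\<lambda>x. fst (w n) x - u x)) \<longlonglongrightarrow> 0" "(\<lambda>n. G.nrm (\<lambda>x. snd (w n) x - g x)) \<longlonglongrightarrow> 0"
      using QH_0_E[OF ug] by blast
    have "(\<lambda>n. V.nrm (fst (w n))) \<longlonglongrightarrow> V.nrm u"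
      using w u QLip_0_square_int by (intro V.nrm_tendsto) auto
    moreover have "(\<lambda>n. \<bar>C\<bar> * G.nrm (snd (w n))) \<longlonglongrightarrow> \<bar>C\<bar> * G.nrm g"
      using w u QLip_0_square_int by (intro tendsto_mult_left G.nrm_tendsto) auto
    ultimately show ?thesis
      using le[OF w(1)] by (intro LIMSEQ_le) auto
  qed
  ultimately show ?thesis
    using that[of "\<bar>C\<bar>"] by simp
qed

section \<open>Energy and load\<close>

text \<open>
  With \<open>F \<phi>\<close> in the weighted space for every \<open>\<phi>\<close> there, the zeroth order term \<open>\<integral> F u \<phi> v\<close> is an inner product of \<open>u\<close> with
  the fixed element \<open>F \<phi>\<close>, hence continuous in \<open>u\<close>.
\<close>

lemma F_mult_square_int:
  assumes "u \<in> V.square_int"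
  shows "(\<lambda>x. F x * u x) \<in> V.square_int"
proof -
  obtain K where K: "AE x in M. \<bar>F x\<bar> \<le> K"
    using Linfty_AE_bound[OF F_Linfty] .
  have [measurable]: "F \<in> borel_measurable M" "u \<in> borel_measurable M"
    using F_Linfty assms V.square_int_measurable by (auto simp: Linfty_def)
  have "integrable M (\<lambda>x. (F x * u x) * (F x * u x))"
  proof (rule Bochner_Integration.integrable_bound)
    show "integrable M (\<lambda>x. K\<^sup>2 * (u x * u x))"
      using assms by (simp add: V.square_int_def)
    show "AE x in M. norm ((F x * u x) * (F x * u x)) \<le> norm (K\<^sup>2 * (u x * u x))"
      using K
    proof eventually_elim
      case (elim x)
      then have "(F x)\<^sup>2 \<le> K\<^sup>2"
        by (metis abs_ge_zero abs_le_square_iff abs_of_nonneg order_trans)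
      then have "(F x)\<^sup>2 * (u x * u x) \<le> K\<^sup>2 * (u x * u x)"
        by (intro mult_right_mono) auto
      then show ?case
        by (simp add: abs_mult power2_eq_square mult_ac)
    qed
  qed measurable
  then show ?thesis
    by (simp add: V.square_int_def)
qed

lemma F_form_nonneg: "0 \<le> V.ip u (\<lambda>x. F x * u x)"
  unfolding V.ip_def
proof (rule integral_nonneg_AE)
  show "AE x in M. 0 \<le> u x * (F x * u x)"
    using F_nonneg
  proof eventually_elim
    case (elim x)
    have "u x * (F x * u x) = F x * (u x * u x)"
      by simp
    with elim show ?case
      by (metis mult_nonneg_nonneg zero_le_square)
  qed
qed

definition energy :: "(real^'n \<Rightarrow> real) \<times> (real^'n \<Rightarrow> real^'n) \<Rightarrow>
    (real^'n \<Rightarrow> real) \<times> (real^'n \<Rightarrow> real^'n) \<Rightarrow> real" where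
  "energy w z = G.ip (snd w) (snd z) + V.ip (fst w) (\<lambda>x. F x * fst z x)"

lemma energy_sym: "energy w z = energy z w"
  by (simp add: energy_def G.ip_sym[of "snd w"] V.ip_def mult_ac)

lemma energy_comb:
  assumes "fst w \<in> V.square_int" "snd w \<in> G.square_int" "fst z \<in> V.square_int" "snd z \<in> G.square_int" "fst y \<in> V.square_int" "snd y \<in> G.square_int"
  shows "energy (comb s w z) y = energy w y + s * energy z y"
  unfolding energy_def comb_def fst_conv snd_conv
  using assms F_mult_square_int by (simp only: V.ip_comb_left G.ip_comb_left) (simp add: algebra_simps)

text \<open>
  Coercivity, the place where \<open>F \<ge> 0\<close> enters: the energy controls the gradient component, and through
  the Poincare inequality the function component as well.
\<close>

lemma G_nrm_le_energy: "(G.nrm (snd w))\<^sup>2 \<le> energy w w"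
  using F_form_nonneg by (simp add: energy_def G.nrm_power2)

lemma energy_nonneg: "0 \<le> energy w w"
  using G_nrm_le_energy[of w] by (meson order_trans zero_le_power2)

lemma energy_tendsto:
  assumes "\<And>n. fst (w n) \<in> V.square_int" "\<And>n. snd (w n) \<in> G.square_int" "u \<in> V.square_int" "g \<in> G.square_int"
    and "fst z \<in> V.square_int" "snd z \<in> G.square_int"
    and "(\<lambda>n. V.nrm (\<lambda>x. fst (w n) x - u x)) \<longlonglongrightarrow> 0"
    and "(\<lambda>n. G.nrm (\<lambda>x. snd (w n) x - g x)) \<longlonglongrightarrow> 0"
  shows "(\<lambda>n. energy (w n) z) \<longlonglongrightarrow> energy (u, g) z"
  unfolding energy_def fst_conv snd_conv
  using assms F_mult_square_int by (intro tendsto_add V.ip_tendsto G.ip_tendsto) auto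

definition load :: "(real^'n \<Rightarrow> real) \<Rightarrow> ('N::finite \<Rightarrow> real^'n \<Rightarrow> real^'n) \<Rightarrow> (real^'n \<Rightarrow> real^'N) \<Rightarrow>
    (real^'n \<Rightarrow> real) \<times> (real^'n \<Rightarrow> real^'n) \<Rightarrow> real" where
  "load f t g w = V.ip f (fst w) + (\<Sum>i\<in>UNIV. V.ip (\<lambda>x. g x $ i) (\<lambda>x. t i x \<bullet> snd w x))"

lemma subunit_square_int:
  assumes "degenerate_subunit \<Omega> v Q t" "w \<in> S"
  shows "(\<lambda>x. t x \<bullet> snd w x) \<in> V.square_int"
  using assms QLip_0_subset_QH by (fastforce simp: degenerate_subunit_def L2_eq)

lemma load_comb:
  assumes f: "f \<in> L2 M" and g: "g \<in> L2 M" and t: "\<And>i. degenerate_subunit \<Omega> v Q (t i)"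
    and w: "w \<in> S" and z: "z \<in> S"
  shows "load f t g (comb s w z) = load f t g w + s * load f t g z"
proof -
  have right: "V.ip k (\<lambda>x. a x + s *\<^sub>R b x) = V.ip k a + s * V.ip k b"
    if "k \<in> V.square_int" "a \<in> V.square_int" "b \<in> V.square_int" for k a b
    using V.ip_comb_left[OF that(2,3,1), of s] by (simp only: V.ip_sym[of k])
  have "V.ip (\<lambda>x. g x $ i) (\<lambda>x. t i x \<bullet> snd (comb s w z) x)
      = V.ip (\<lambda>x. g x $ i) (\<lambda>x. t i x \<bullet> snd w x) + s * V.ip (\<lambda>x. g x $ i) (\<lambda>x. t i x \<bullet> snd z x)" for i
    using right[of "\<lambda>x. g x $ i", OF _ subunit_square_int[OF t w] subunit_square_int[OF t z]] L2_component[OF g]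
    by (simp add: L2_eq comb_def inner_add_right)
  moreover have "V.ip f (fst (comb s w z)) = V.ip f (fst w) + s * V.ip f (fst z)"
    using right[of f] f QLip_0_square_int w z by (simp add: comb_def L2_eq)
  ultimately show ?thesis
    by (simp add: load_def sum.distrib sum_distrib_left algebra_simps)
qed

text \<open>
  Cauchy-Schwarz, then the subunit estimate for each \<open>T\<^sub>i \<phi>\<close>, then the Poincare inequality to absorb
  the norm of \<open>\<phi>\<close> into that of its gradient.
\<close>

lemma load_bound:
  assumes f: "f \<in> L2 M" and g: "g \<in> L2 M" and t: "\<And>i. degenerate_subunit \<Omega> v Q (t i)"
  obtains K where "\<And>w. w \<in> S \<Longrightarrow> \<bar>load f t g w\<bar> \<le> K * sqrt (energy w w)"
proof -
  obtain C where C: "0 \<le> C" "\<And>w. w \<in> S \<Longrightarrow> V.nrm (fst w) \<le> C * G.nrm (snd w)"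
    by (rule QH_0_poincare) blast
  have "\<exists>D. \<forall>w\<in>S. V.nrm (\<lambda>x. t i x \<bullet> snd w x) \<le> D * (V.nrm (fst w) + G.nrm (snd w))" for i
    using t[of i] QLip_0_subset_QH by (fastforce simp: degenerate_subunit_def L2_norm_eq QH_norm_eq)
  then have "\<forall>i. \<exists>D. \<forall>w\<in>S. V.nrm (\<lambda>x. t i x \<bullet> snd w x) \<le> D * (V.nrm (fst w) + G.nrm (snd w))"
    by blast
  from choice[OF this]
  obtain D where D: "\<And>i w. w \<in> S \<Longrightarrow> V.nrm (\<lambda>x. t i x \<bullet> snd w x) \<le> D i * (V.nrm (fst w) + G.nrm (snd w))"
    by blast
  have subunit: "V.nrm (\<lambda>x. t i x \<bullet> snd w x) \<le> \<bar>D i\<bar> * (C + 1) * G.nrm (snd w)" if w: "w \<in> S" for i w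
  proof -
    have "V.nrm (\<lambda>x. t i x \<bullet> snd w x) \<le> D i * (V.nrm (fst w) + G.nrm (snd w))"
      by (rule D[OF w])
    also have "\<dots> \<le> \<bar>D i\<bar> * (C * G.nrm (snd w) + G.nrm (snd w))"
      using C(2)[OF w] V.nrm_nonneg[of "fst w"] G.nrm_nonneg[of "snd w"] by (intro mult_mono) auto
    finally show ?thesis
      by (simp add: algebra_simps)
  qed
  define K where "K = V.nrm f * C + (\<Sum>i\<in>UNIV. V.nrm (\<lambda>x. g x $ i) * (\<bar>D i\<bar> * (C + 1)))"
  have "\<bar>load f t g w\<bar> \<le> K * sqrt (energy w w)" if w: "w \<in> S" for w
  proof -
    have "\<bar>V.ip f (fst w)\<bar> \<le> V.nrm f * V.nrm (fst w)"
      using f QLip_0_square_int[OF w] by (intro V.Cauchy_Schwarz_ip) (auto simp: L2_eq)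
    also have "\<dots> \<le> V.nrm f * (C * G.nrm (snd w))"
      by (intro mult_left_mono C(2) w V.nrm_nonneg)
    finally have 1: "\<bar>V.ip f (fst w)\<bar> \<le> V.nrm f * (C * G.nrm (snd w))" .
    have 2: "\<bar>V.ip (\<lambda>x. g x $ i) (\<lambda>x. t i x \<bullet> snd w x)\<bar>
        \<le> V.nrm (\<lambda>x. g x $ i) * (\<bar>D i\<bar> * (C + 1) * G.nrm (snd w))" for i
    proof -
      have "\<bar>V.ip (\<lambda>x. g x $ i) (\<lambda>x. t i x \<bullet> snd w x)\<bar>
          \<le> V.nrm (\<lambda>x. g x $ i) * V.nrm (\<lambda>x. t i x \<bullet> snd w x)"
        using L2_component[OF g] subunit_square_int[OF t w] by (intro V.Cauchy_Schwarz_ip) (auto simp: L2_eq)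
      also have "\<dots> \<le> V.nrm (\<lambda>x. g x $ i) * (\<bar>D i\<bar> * (C + 1) * G.nrm (snd w))"
        by (intro mult_left_mono subunit w V.nrm_nonneg)
      finally show ?thesis .
    qed
    have "\<bar>load f t g w\<bar> \<le> \<bar>V.ip f (fst w)\<bar> + (\<Sum>i\<in>UNIV. \<bar>V.ip (\<lambda>x. g x $ i) (\<lambda>x. t i x \<bullet> snd w x)\<bar>)"
      unfolding load_def by (intro order_trans[OF abs_triangle_ineq] add_left_mono sum_abs)
    also have "\<dots> \<le> V.nrm f * (C * G.nrm (snd w))
        + (\<Sum>i\<in>UNIV. V.nrm (\<lambda>x. g x $ i) * (\<bar>D i\<bar> * (C + 1) * G.nrm (snd w)))"
      by (intro add_mono sum_mono 1 2)
    also have "\<dots> = K * G.nrm (snd w)"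
      by (simp add: K_def distrib_right sum_distrib_right mult.assoc)
    also have "\<dots> \<le> K * sqrt (energy w w)"
    proof (rule mult_left_mono)
      show "G.nrm (snd w) \<le> sqrt (energy w w)"
        using real_le_rsqrt[OF G_nrm_le_energy] .
      show "0 \<le> K"
        unfolding K_def using C(1) V.nrm_nonneg
        by (intro add_nonneg_nonneg mult_nonneg_nonneg sum_nonneg) auto
    qed
    finally show ?thesis .
  qed
  then show ?thesis
    using that by blast
qed

lemma weak_solution_iff:
  assumes f: "f \<in> L2 M" and g: "g \<in> L2 M" and t: "\<And>i. degenerate_subunit \<Omega> v Q (t i)"
  shows "degenerate_weak_solution \<Omega> v Q F f t g (u, du) \<longleftrightarrow>
    (u, du) \<in> QH_0 \<Omega> v Q \<and> (\<forall>w\<in>S. energy (u, du) w = load f t g w)"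
proof -
  have "(LINT x|lebesgue_on \<Omega>. (Q x *v du x) \<bullet> d\<phi> x) = G.ip d\<phi> du" for d\<phi>
    by (simp add: G.ip_def inner_commute)
  then have "(LINT x|lebesgue_on \<Omega>. (Q x *v du x) \<bullet> d\<phi> x) + (LINT x|M. F x * u x * \<phi> x) = energy (u, du) (\<phi>, d\<phi>)"
    for \<phi> d\<phi>
    by (simp add: energy_def V.ip_def G.ip_sym[of du d\<phi>] mult_ac)
  moreover have "(LINT x|M. f x * \<phi> x) + (LINT x|M. (\<Sum>i\<in>UNIV. g x $ i * (t i x \<bullet> d\<phi> x))) = load f t g (\<phi>, d\<phi>)"
    if "(\<phi>, d\<phi>) \<in> S" for \<phi> d\<phi>
  proof -
    have "integrable M (\<lambda>x. g x $ i * (t i x \<bullet> d\<phi> x))" for i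
      using V.integrable_A[of "\<lambda>x. g x $ i", OF _ subunit_square_int[OF t that, of i]] L2_component[OF g, of i]
      by (simp add: L2_eq)
    then show ?thesis
      by (simp add: load_def V.ip_def)
  qed
  ultimately show ?thesis
    unfolding degenerate_weak_solution_def by (auto simp: case_prod_beta)
qed

section \<open>Existence and uniqueness\<close>

text \<open>
  A minimizing sequence in the Lipschitz class is Cauchy in \<open>QL\<^sup>2\<close> by coercivity and in \<open>L\<^sup>2(v)\<close> by the
  Poincare inequality. The limits of its two components form a pair in \<open>QH\<^sub>0\<close> by construction, and the
  energy against a fixed test function is continuous, so the limit solves the equation.
\<close>

theorem weak_solution_exists:
  assumes f: "f \<in> L2 M" and g: "g \<in> L2 M" and t: "\<And>i. degenerate_subunit \<Omega> v Q (t i)"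
  shows "\<exists>u du. degenerate_weak_solution \<Omega> v Q F f t g (u, du)"
proof -
  obtain C where C: "0 \<le> C" "\<And>w. w \<in> S \<Longrightarrow> V.nrm (fst w) \<le> C * G.nrm (snd w)"
    by (rule QH_0_poincare) blast
  obtain K where K: "\<And>w. w \<in> S \<Longrightarrow> \<bar>load f t g w\<bar> \<le> K * sqrt (energy w w)"
    by (rule load_bound[where t = t, OF f g t]) blast
  have "\<exists>w::nat \<Rightarrow> _. (\<forall>n. w n \<in> S) \<and>
    (\<forall>e>0. \<exists>N. \<forall>m\<ge>N. \<forall>n\<ge>N. energy (comb (-1) (w m) (w n)) (comb (-1) (w m) (w n)) < e) \<and>
    (\<forall>z\<in>S. (\<lambda>n. energy (w n) z) \<longlonglongrightarrow> load f t g z)"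
  proof (rule energy_minimizing_sequence[where S = S and B = energy and L = "load f t g" and comb = comb and K = K])
    show "energy (comb s a b) c = energy a c + s * energy b c" if "a \<in> S" "b \<in> S" "c \<in> S" for s a b c
      using that by (intro energy_comb QLip_0_square_int)
    show "load f t g (comb s a b) = load f t g a + s * load f t g b" if "a \<in> S" "b \<in> S" for s a b
      by (rule load_comb[where t = t, OF f g t that])
  qed (rule nonempty QLip_0_comb energy_sym energy_nonneg K; assumption)+
  then obtain w where w: "\<And>n::nat. w n \<in> S"
    and Cauchy: "\<And>e. 0 < e \<Longrightarrow> \<exists>N. \<forall>m\<ge>N. \<forall>n\<ge>N. energy (comb (-1) (w m) (w n)) (comb (-1) (w m) (w n)) < e"
    and weak: "\<And>z. z \<in> S \<Longrightarrow> (\<lambda>n. energy (w n) z) \<longlonglongrightarrow> load f t g z"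
    by metis
  have Cauchy_G: "\<exists>N. \<forall>m\<ge>N. \<forall>n\<ge>N. G.nrm (\<lambda>x. snd (w m) x - snd (w n) x) < e" if "0 < e" for e
  proof -
    obtain N where N: "\<And>m n. N \<le> m \<Longrightarrow> N \<le> n \<Longrightarrow> energy (comb (-1) (w m) (w n)) (comb (-1) (w m) (w n)) < e\<^sup>2"
      using Cauchy[of "e\<^sup>2"] \<open>0 < e\<close> by auto
    have "G.nrm (\<lambda>x. snd (w m) x - snd (w n) x) < e" if "N \<le> m" "N \<le> n" for m n
    proof (rule power2_less_imp_less)
      show "(G.nrm (\<lambda>x. snd (w m) x - snd (w n) x))\<^sup>2 < e\<^sup>2"
        using G_nrm_le_energy[of "comb (-1) (w m) (w n)"] N[OF that] by (simp add: comb_minus_1)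
    qed (use \<open>0 < e\<close> in simp)
    then show ?thesis
      by blast
  qed
  \<comment> \<open>dividing by \<open>C + 1\<close> instead of \<open>C\<close> allows for a vanishing Poincare constant\<close>
  have Cauchy_V: "\<exists>N. \<forall>m\<ge>N. \<forall>n\<ge>N. V.nrm (\<lambda>x. fst (w m) x - fst (w n) x) < e" if "0 < e" for e
  proof -
    obtain N where N: "\<And>m n. N \<le> m \<Longrightarrow> N \<le> n \<Longrightarrow> G.nrm (\<lambda>x. snd (w m) x - snd (w n) x) < e / (C + 1)"
      using Cauchy_G[of "e / (C + 1)"] \<open>0 < e\<close> C(1) by auto
    have "V.nrm (\<lambda>x. fst (w m) x - fst (w n) x) < e" if "N \<le> m" "N \<le> n" for m n
    proof -
      have "V.nrm (\<lambda>x. fst (w m) x - fst (w n) x) \<le> C * G.nrm (\<lambda>x. snd (w m) x - snd (w n) x)"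
        using C(2)[OF QLip_0_comb[OF w w], of "-1" m n] by (simp add: comb_minus_1)
      also have "\<dots> \<le> (C + 1) * G.nrm (\<lambda>x. snd (w m) x - snd (w n) x)"
        by (intro mult_right_mono G.nrm_nonneg) simp
      also have "\<dots> < e"
        using N[OF that] C(1) by (simp add: field_simps)
      finally show ?thesis .
    qed
    then show ?thesis
      by blast
  qed
  obtain u where u: "u \<in> V.square_int" "(\<lambda>n. V.nrm (\<lambda>x. fst (w n) x - u x)) \<longlonglongrightarrow> 0"
    using V.square_int_complete[of "\<lambda>n. fst (w n)", OF QLip_0_square_int(1)[OF w] Cauchy_V] by blast
  obtain du where du: "du \<in> G.square_int" "(\<lambda>n. G.nrm (\<lambda>x. snd (w n) x - du x)) \<longlonglongrightarrow> 0"
    using G.square_int_complete[of "\<lambda>n. snd (w n)", OF QLip_0_square_int(2)[OF w] Cauchy_G] by blast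
  have "(u, du) \<in> QH_0 \<Omega> v Q"
    by (rule QH_0_I[OF w u(1) du(1) u(2) du(2)])
  moreover have "energy (u, du) z = load f t g z" if z: "z \<in> S" for z
  proof (rule LIMSEQ_unique)
    show "(\<lambda>n. energy (w n) z) \<longlonglongrightarrow> energy (u, du) z"
      using QLip_0_square_int w z u du by (intro energy_tendsto) auto
    show "(\<lambda>n. energy (w n) z) \<longlonglongrightarrow> load f t g z"
      by (rule weak[OF z])
  qed
  ultimately show ?thesis
    using weak_solution_iff[where t = t, OF f g t] by blast
qed

text \<open>
  The element of \<open>QH\<^sub>0\<close> may itself be approximated by test functions, so its own energy vanishes.
  Coercivity kills the gradient component, which is not determined by the function component and has
  to be treated separately; the Poincare inequality then kills the function. Invertibility of
  \<open>Q\<close> and positivity of \<open>v\<close> almost everywhere turn vanishing norms into vanishing functions.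
\<close>

lemma energy_orthogonal_imp_AE_zero:
  assumes ug: "(u, g) \<in> QH_0 \<Omega> v Q" and orth: "\<And>w. w \<in> S \<Longrightarrow> energy (u, g) w = 0"
  shows "AE x in lebesgue_on \<Omega>. u x = 0 \<and> g x = 0"
proof -
  obtain w where H: "u \<in> V.square_int" "g \<in> G.square_int" and w: "\<And>n::nat. w n \<in> S"
    "(\<lambda>n. V.nrm (\<lambda>x. fst (w n) x - u x)) \<longlonglongrightarrow> 0" "(\<lambda>n. G.nrm (\<lambda>x. snd (w n) x - g x)) \<longlonglongrightarrow> 0"
    using QH_0_E[OF ug] by blast
  have "(\<lambda>n. energy (w n) (u, g)) \<longlonglongrightarrow> energy (u, g) (u, g)"
    using QLip_0_square_int w H by (intro energy_tendsto) auto
  moreover have "energy (w n) (u, g) = 0" for n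
    using orth[OF w(1)] by (simp add: energy_sym[of "w n"])
  ultimately have "energy (u, g) (u, g) = 0"
    by (simp add: LIMSEQ_const_iff)
  then have "(G.nrm g)\<^sup>2 \<le> 0"
    using G_nrm_le_energy[of "(u, g)"] by simp
  then have g0: "G.nrm g = 0"
    by simp
  obtain C where "V.nrm u \<le> C * G.nrm g"
    using QH_0_poincare ug by metis
  then have "V.nrm u = 0"
    using g0 V.nrm_nonneg[of u] by simp
  then have "AE x in M. u x = 0"
    by (rule V.nrm_eq_0_imp_AE[OF H(1)])
  then have "AE x in lebesgue_on \<Omega>. 0 < v x \<longrightarrow> u x = 0"
    using weight by (simp add: AE_density weight_def)
  moreover have "AE x in lebesgue_on \<Omega>. 0 < v x"
    using weight by (auto simp: weight_def)
  moreover have "AE x in lebesgue_on \<Omega>. g x = 0"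
    by (rule G.nrm_eq_0_imp_AE[OF H(2) g0])
  ultimately show ?thesis
    by eventually_elim simp
qed

theorem weak_solution_unique:
  assumes f: "f \<in> L2 M" and g: "g \<in> L2 M" and t: "\<And>i. degenerate_subunit \<Omega> v Q (t i)"
    and sol: "degenerate_weak_solution \<Omega> v Q F f t g (u, du)"
    and sol': "degenerate_weak_solution \<Omega> v Q F f t g (u', du')"
  shows "AE x in lebesgue_on \<Omega>. u' x = u x \<and> du' x = du x"
proof -
  note iff = weak_solution_iff[where t = t, OF f g t]
  have QH: "(u, du) \<in> QH_0 \<Omega> v Q" "(u', du') \<in> QH_0 \<Omega> v Q"
    using sol sol' iff by auto
  then have H: "u \<in> V.square_int" "du \<in> G.square_int" "u' \<in> V.square_int" "du' \<in> G.square_int"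
    by (auto elim: QH_0_E)
  have "energy (\<lambda>x. u' x - u x, \<lambda>x. du' x - du x) w = 0" if w: "w \<in> S" for w
    using energy_comb[of "(u', du')" "(u, du)" w "-1"] H QLip_0_square_int[OF w] sol sol' w iff
    by (simp add: comb_minus_1)
  then have "AE x in lebesgue_on \<Omega>. u' x - u x = 0 \<and> du' x - du x = 0"
    by (rule energy_orthogonal_imp_AE_zero[OF QH_0_diff[OF QH(2,1)]])
  then show ?thesis
    by simp
qed

end

theorem theorem3p6:
  fixes \<Omega> :: "(real^'n) set"
    and v :: "real^'n \<Rightarrow> ennreal"
    and Q :: "real^'n \<Rightarrow> real^'n^'n"
    and f F :: "real^'n \<Rightarrow> real"
    and t :: "'N::finite \<Rightarrow> real^'n \<Rightarrow> real^'n"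
    and g :: "real^'n \<Rightarrow> real^'N"
  assumes "bounded \<Omega>" "connected \<Omega>" "open \<Omega>"
    and "weight \<Omega> v"
    and "matrix_function \<Omega> Q"
    and nontrivial: "\<exists>(\<phi>, h)\<in>QLip_0 \<Omega> v Q. \<exists>x\<in>\<Omega>. \<phi> x \<noteq> 0"
    and poincare: "\<exists>C. \<forall>(\<phi>, h)\<in>QLip_0 \<Omega> v Q. L2_norm (weighted \<Omega> v) \<phi> \<le> C * QL2_norm \<Omega> Q h"
    and "f \<in> L2 (weighted \<Omega> v)"
    and "g \<in> L2 (weighted \<Omega> v)"
    and "\<And>i. degenerate_subunit \<Omega> v Q (t i)"
    and "F \<in> Linfty (weighted \<Omega> v)"
    and "AE x in weighted \<Omega> v. 0 \<le> F x"
  shows "\<exists>u du. degenerate_weak_solution \<Omega> v Q F f t g (u, du) \<and>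
    (\<forall>u' du'. degenerate_weak_solution \<Omega> v Q F f t g (u', du') \<longrightarrow>
       (AE x in lebesgue_on \<Omega>. u' x = u x \<and> du' x = du x))"
proof -
  interpret degenerate_Dirichlet \<Omega> v Q F
    using assms by unfold_locales auto
  obtain u du where "degenerate_weak_solution \<Omega> v Q F f t g (u, du)"
    using weak_solution_exists[where t = t, OF assms(8,9,10)] by blast
  then show ?thesis
    using weak_solution_unique[where t = t, OF assms(8,9,10)] by blast
qed

end
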